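(* (i) $\mathfrak{V}=\mathfrak{V}_{\omega_1}$. (ii) $\mathfrak{L}=\mathfrak{V}_0$. (iii) For any $0\leqslant\xi\leqslant\zeta\leqslant\omega_1$, $\mathfrak{V}_\zeta\subset\mathfrak{V}_\xi$. (iv) For any $0<\xi<\omega_1$, there exist Banach spaces $X,Y$ and an operator $A:X\to Y$ such that $\mathsf{v}(A)=\xi$, whence for any $0\leqslant\xi<\zeta\leqslant\omega_1$, $\mathfrak{V}_\zeta\subsetneq\mathfrak{V}_\xi$.
   Context: Banach spaces are over $\mathbb{K}\in\{\mathbb{R},\mathbb{C}\}$; operators are bounded and linear; $\mathfrak{L}$ is the class of all operators between Banach spaces and $\mathfrak{V}$ the class of completely continuous operators (those sending weakly null sequences to norm null sequences). $\mathbb{N}=\{1,2,\ldots\}$. For $M\subset\mathbb{N}$, $[M]$ (resp. $[M]^{<\mathbb{N}}$) is the set of infinite (resp. finite) subsets of $M$. For $M=\{m_1<m_2<\ldots\}\in[\mathbb{N}]$ and $\mathcal{F}\subset[\mathbb{N}]^{<\mathbb{N}}$, $\mathcal{F}(M)=\{\{m_n:n\in E\}:E\in\mathcal{F}\}$. $E<F$ means $E=\varnothing$ or $F=\varnothing$ or $\max E<\min F$; $n\leqslant E$ means $n\leqslant\min E$ (true if $E=\varnothing$). Schreier families: $\mathcal{S}_0=\{E\in[\mathbb{N}]^{<\mathbb{N}}:|E|\leqslant 1\}$; $\mathcal{S}_{\xi+1}=\{\varnothing\}\cup\{\bigcup_{i=1}^nE_i:\varnothing\neq E_i\in\mathcal{S}_\xi,\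 n\leqslant E_1,\ E_1<\ldots<E_n\}$; for a limit ordinal $\xi<\omega_1$, $\mathcal{S}_\xi=\{E\in[\mathbb{N}]^{<\mathbb{N}}:\exists n\leqslant E\in\mathcal{S}_{\xi_n+1}\}$ for a fixed sequence $\xi_n\uparrow\xi$ with $\mathcal{S}_{\xi_n+1}\subset\mathcal{S}_{\xi_{n+1}}$ for all $n$. For a sequence $(x_i)_{i=1}^\infty$ in a Banach space $X$ and $\varepsilon>0$, $\mathfrak{F}^a_\varepsilon((x_i)_{i=1}^\infty)=\{\varnothing\}\cup\{F\in[\mathbb{N}]^{<\mathbb{N}}:(\exists x^*\in B_{X^*})(\forall n\in F)(|x^*(x_n)|\geqslant\varepsilon)\}$. For $\xi<\omega_1$, $(x_i)$ is $\xi$-weakly null if there do not exist $\varepsilon>0$ and $N\in[\mathbb{N}]$ with $\mathcal{S}_\xi(N)\subset\mathfrak{F}^a_\varepsilon((x_i)_{i=1}^\infty)$; $\omega_1$-weakly null means weakly null. For $0\leqslant\xi\leqslant\omega_1$, $A:X\to Y$ is $\xi$-completely continuous if it sends every $\xi$-weakly null sequence in $X$ to a norm null sequence in $Y$; $\mathfrak{V}_\xi$ is the class of such operators. $\mathsf{v}(A)$ is the minimum countable ordinal $\xi$ such that $A$ is not $\xi$-completely continuous if such an ordinal exists, and $\mathsf{v}(A)=\omega_1$ otherwise. *)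

theory Defs
  imports
    Complex_Main
    "HOL-Library.Function_Algebras"
    "HOL-Library.Countable_Set"
    "HOL-Library.Infinite_Set"
begin

section \<open>Ordinals up to the first uncountable one\<close>

text \<open>
  The cardinal successor of \<open>natLeq\<close> is a well-order of type \<open>\<omega>\<^sub>1\<close>, so the points of its
  field, ordered by it, are the countable ordinals.
\<close>

typedef countable_ordinal = "Field (cardSuc natLeq)"
  using Field_cardSuc_not_empty[OF natLeq_Card_order] by blast

setup_lifting type_definition_countable_ordinal

instantiation countable_ordinal :: wellorder
begin

lift_definition less_eq_countable_ordinal ::
  "countable_ordinal \<Rightarrow> countable_ordinal \<Rightarrow> bool"
  is "\<lambda>x y. (x, y) \<in> cardSuc natLeq" .

definition less_countable_ordinal :: "countable_ordinal \<Rightarrow> countable_ordinal \<Rightarrow> bool"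
  where "x < y \<longleftrightarrow> x \<le> y \<and> x \<noteq> (y :: countable_ordinal)"

instance
proof -
  let ?r = "cardSuc natLeq"
  have wo: "Well_order ?r"
    by (rule cardSuc_Well_order[OF natLeq_Card_order])
  then have refl: "\<And>x. x \<in> Field ?r \<Longrightarrow> (x, x) \<in> ?r"
    and trans: "\<And>x y z. (x, y) \<in> ?r \<Longrightarrow> (y, z) \<in> ?r \<Longrightarrow> (x, z) \<in> ?r"
    and antisym: "\<And>x y. (x, y) \<in> ?r \<Longrightarrow> (y, x) \<in> ?r \<Longrightarrow> x = y"
    and total: "\<And>x y. x \<in> Field ?r \<Longrightarrow> y \<in> Field ?r \<Longrightarrow> x \<noteq> y \<Longrightarrow> (x, y) \<in> ?r \<or> (y, x) \<in> ?r"
    and wf: "wf (?r - Id)"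
    unfolding order_on_defs refl_on_def trans_def antisym_def total_on_def well_order_on_def
    by blast+
  have o: "(x \<le> y) \<longleftrightarrow> (Rep_countable_ordinal x, Rep_countable_ordinal y) \<in> ?r" for x y
    by (rule less_eq_countable_ordinal.rep_eq)
  have l: "(x < y) \<longleftrightarrow> (Rep_countable_ordinal x, Rep_countable_ordinal y) \<in> ?r - Id" for x y
    by (auto simp: less_countable_ordinal_def o Rep_countable_ordinal_inject)
  have "{(x, y). x < (y :: countable_ordinal)} = inv_image (?r - Id) Rep_countable_ordinal"
    by (auto simp: l inv_image_def)
  then have wf': "wf {(x, y). x < (y :: countable_ordinal)}"
    using wf by (simp add: wf_inv_image)
  show "OFCLASS(countable_ordinal, wellorder_class)"
  proof
    fix x y z :: countable_ordinal
    show "x \<le> x" by (simp add: o refl Rep_countable_ordinal)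
    show "x \<le> y \<Longrightarrow> y \<le> z \<Longrightarrow> x \<le> z" unfolding o by (rule trans)
    show anti: "x \<le> y \<Longrightarrow> y \<le> x \<Longrightarrow> x = y"
      unfolding o by (metis antisym Rep_countable_ordinal_inject)
    show "x \<le> y \<or> y \<le> x"
      unfolding o by (metis total refl Rep_countable_ordinal)
    show "x < y \<longleftrightarrow> x \<le> y \<and> \<not> y \<le> x"
      unfolding less_countable_ordinal_def using anti \<open>x \<le> x\<close>
      by (metis antisym o Rep_countable_ordinal_inject)
  next
    fix P :: "countable_ordinal \<Rightarrow> bool" and a
    assume "\<And>x. (\<And>y. y < x \<Longrightarrow> P y) \<Longrightarrow> P x"
    then show "P a" using wf_induct_rule[OF wf', of P a] by auto
  qed
qed

end

lemma uncountable_countable_ordinals: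
  includes cardinal_syntax
  shows "uncountable (UNIV :: countable_ordinal set)"
proof
  assume "countable (UNIV :: countable_ordinal set)"
  then have "countable (range Rep_countable_ordinal)" by (rule countable_image)
  then have "countable (Field (cardSuc natLeq))"
    using type_definition.Rep_range[OF type_definition_countable_ordinal] by simp
  then have "|Field (cardSuc natLeq)| \<le>o natLeq"
    unfolding countable_def
    by (metis card_of_ordLeq card_of_nat ordLeq_ordIso_trans subset_UNIV)
  then have "cardSuc natLeq \<le>o natLeq"
    by (metis card_of_Field_ordIso cardSuc_Card_order natLeq_Card_order
        ordIso_ordLeq_trans ordIso_symmetric)
  then show False
    using cardSuc_greater[OF natLeq_Card_order] not_ordLess_ordLeq by blast
qed

lemma countable_below:
  includes cardinal_syntax
  shows "countable {y. y < (x :: countable_ordinal)}"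
proof -
  let ?r = "cardSuc natLeq"
  have "|underS ?r (Rep_countable_ordinal x)| <o ?r"
    by (rule card_of_underS[OF cardSuc_Card_order[OF natLeq_Card_order]])
      (rule Rep_countable_ordinal)
  then have "|underS ?r (Rep_countable_ordinal x)| \<le>o natLeq"
    by (metis cardSuc_ordLess_ordLeq card_of_Card_order cardSuc_Card_order natLeq_Card_order
        cardSuc_ordLeq_ordLess)
  then have "countable (underS ?r (Rep_countable_ordinal x))"
    unfolding countable_def
    by (metis card_of_ordLeq card_of_nat ordLeq_ordIso_trans ordIso_symmetric)
  moreover have "Rep_countable_ordinal ` {y. y < x} \<subseteq> underS ?r (Rep_countable_ordinal x)"
    by (auto simp: underS_def less_countable_ordinal_def less_eq_countable_ordinal.rep_eq
        Rep_countable_ordinal_inject)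
  ultimately have "countable (Rep_countable_ordinal ` {y. y < x})"
    by (rule countable_subset[rotated])
  then show ?thesis
    by (rule countable_image_inj_on) (simp add: inj_on_def Rep_countable_ordinal_inject)
qed

instantiation countable_ordinal :: zero
begin
definition zero_countable_ordinal :: countable_ordinal where "0 = (LEAST x :: countable_ordinal. True)"
instance ..
end

definition ord_succ :: "countable_ordinal \<Rightarrow> countable_ordinal"
  where "ord_succ x = (LEAST y. x < y)"

definition ord_limit :: "countable_ordinal \<Rightarrow> bool"
  where "ord_limit x \<longleftrightarrow> x \<noteq> 0 \<and> (\<forall>y. x \<noteq> ord_succ y)"

lemma less_ord_succ: "x < ord_succ x"
proof -
  have "\<exists>y. x < y"
  proof (rule ccontr)
    assume "\<nexists>y. x < y"
    then have "UNIV = insert x {y. y < x}" using not_less_iff_gr_or_eq by auto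
    then show False
      using countable_below[of x] uncountable_countable_ordinals by (metis countable_insert)
  qed
  then show ?thesis unfolding ord_succ_def by (rule LeastI_ex)
qed

text \<open>The ordinals \<open>\<xi> \<le> \<omega>\<^sub>1\<close>: the countable ones and \<open>\<omega>\<^sub>1\<close>.\<close>

datatype ordinal = Ctbl countable_ordinal | Omega1

instantiation ordinal :: "{linorder, zero}"
begin

definition zero_ordinal :: ordinal where "0 = Ctbl 0"

fun less_eq_ordinal :: "ordinal \<Rightarrow> ordinal \<Rightarrow> bool" where
  "Ctbl x \<le> Ctbl y \<longleftrightarrow> x \<le> y"
| "x \<le> Omega1 \<longleftrightarrow> True"
| "Omega1 \<le> Ctbl y \<longleftrightarrow> False"

definition less_ordinal :: "ordinal \<Rightarrow> ordinal \<Rightarrow> bool"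
  where "x < y \<longleftrightarrow> x \<le> y \<and> \<not> y \<le> (x :: ordinal)"

instance
proof
  fix x y z :: ordinal
  show "x < y \<longleftrightarrow> x \<le> y \<and> \<not> y \<le> x" by (rule less_ordinal_def)
  show "x \<le> x" by (cases x) auto
  show "x \<le> y \<Longrightarrow> y \<le> z \<Longrightarrow> x \<le> z" by (cases x; cases y; cases z) auto
  show "x \<le> y \<Longrightarrow> y \<le> x \<Longrightarrow> x = y" by (cases x; cases y) auto
  show "x \<le> y \<or> y \<le> x" by (cases x; cases y) auto
qed

end

section \<open>Schreier families\<close>

text \<open>
  Here \<open>\<nat>\<close> is \<open>{1, 2, \<dots>}\<close>, that is \<open>{1..} :: nat set\<close>. Accordingly index \<open>0\<close> of a sequence
  \<open>nat \<Rightarrow> _\<close> is never looked at.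
\<close>

definition set_below :: "nat set \<Rightarrow> nat set \<Rightarrow> bool"
  where "set_below E F \<longleftrightarrow> E = {} \<or> F = {} \<or> Max E < Min F"

definition nat_below :: "nat \<Rightarrow> nat set \<Rightarrow> bool"
  where "nat_below n E \<longleftrightarrow> E = {} \<or> n \<le> Min E"

definition schreier_zero :: "nat set set"
  where "schreier_zero = {E. finite E \<and> E \<subseteq> {1..} \<and> card E \<le> 1}"

definition schreier_next :: "nat set set \<Rightarrow> nat set set"
  where "schreier_next F = {{}} \<union>
    {\<Union>i\<in>{1..n}. E i | n E.
       1 \<le> n \<and> (\<forall>i\<in>{1..n}. E i \<noteq> {} \<and> E i \<in> F) \<and>
       nat_below n (E 1) \<and> (\<forall>i\<in>{1..<n}. set_below (E i) (E (Suc i)))}"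

text \<open>
  The families depend on the sequences \<open>L \<xi> = (\<xi>\<^sub>n)\<^sub>n\<close> chosen at the limit ordinals \<open>\<xi>\<close>.
  The following says that \<open>L\<close> is an admissible choice and that \<open>S\<close> is the resulting
  transfinite sequence of families.
\<close>

definition schreier_families ::
  "(countable_ordinal \<Rightarrow> nat \<Rightarrow> countable_ordinal) \<Rightarrow> (countable_ordinal \<Rightarrow> nat set set) \<Rightarrow> bool"
  where "schreier_families L S \<longleftrightarrow>
    S 0 = schreier_zero \<and>
    (\<forall>\<xi>. S (ord_succ \<xi>) = schreier_next (S \<xi>)) \<and>
    (\<forall>\<xi>. ord_limit \<xi> \<longrightarrow>
       strict_mono_on {1..} (L \<xi>) \<and>
       (\<forall>n\<ge>1. L \<xi> n < \<xi>) \<and> (\<forall>\<eta><\<xi>. \<exists>n\<ge>1. \<eta> < L \<xi> n) \<and>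
       (\<forall>n\<ge>1. S (ord_succ (L \<xi> n)) \<subseteq> S (L \<xi> (Suc n))) \<and>
       S \<xi> = {E. finite E \<and> E \<subseteq> {1..} \<and>
                 (\<exists>n\<ge>1. nat_below n E \<and> E \<in> S (ord_succ (L \<xi> n)))})"

text \<open>
  \<open>F(M)\<close>: the \<open>n\<close>-th element \<open>m\<^sub>n\<close> of \<open>M\<close>, counted from \<open>1\<close>, is \<open>enumerate M (n - 1)\<close>.
\<close>

definition spread :: "nat set set \<Rightarrow> nat set \<Rightarrow> nat set set"
  where "spread F M = {(\<lambda>n. enumerate M (n - 1)) ` E | E. E \<in> F}"

section \<open>Banach spaces and operators\<close>

text \<open>
  The scalar field is \<open>\<real>\<close> or \<open>\<complex> = \<real> + \<real>i\<close>, with its usual absolute value.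
\<close>

class real_or_complex = real_normed_field +
  assumes real_or_complex:
    "(\<forall>z. \<exists>a. z = a *\<^sub>R 1) \<or>
     (\<exists>i. i * i = - 1 \<and> (\<forall>z. \<exists>a b. z = a *\<^sub>R 1 + b *\<^sub>R i) \<and>
          (\<forall>a b. norm (a *\<^sub>R 1 + b *\<^sub>R i) = sqrt (a\<^sup>2 + b\<^sup>2)))"

instance real :: real_or_complex
  by standard simp

instance complex :: real_or_complex
proof
  have "\<forall>z. \<exists>a b. z = a *\<^sub>R 1 + b *\<^sub>R \<i>"
    by (metis complex_eq mult.commute scaleR_conv_of_real mult.right_neutral)
  moreover have "\<forall>a b. norm (a *\<^sub>R 1 + b *\<^sub>R \<i>) = sqrt (a\<^sup>2 + b\<^sup>2)"
    by (simp add: cmod_def)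
  ultimately show "(\<forall>z::complex. \<exists>a. z = a *\<^sub>R 1) \<or>
     (\<exists>i::complex. i * i = - 1 \<and> (\<forall>z. \<exists>a b. z = a *\<^sub>R 1 + b *\<^sub>R i) \<and>
          (\<forall>a b. norm (a *\<^sub>R 1 + b *\<^sub>R i) = sqrt (a\<^sup>2 + b\<^sup>2)))"
    by (intro disjI2 exI[of _ "\<i>"]) simp
qed

text \<open>
  The class \<open>banach\<close> covers real scalars only, and there is no quantifying existentially over
  types. So a normed space is given by a carrier, which is a linear subspace of
  an ambient vector space \<open>'v\<close>, and a norm whose values matter on the carrier only.
  Every Banach space arises in this way, and every separable one already with the ambient
  space \<open>nat \<Rightarrow> 'k\<close> (countably many functionals separate its points).
\<close>

record ('k, 'v) nspace =
  carrier :: "'v set"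
  scale :: "'k \<Rightarrow> 'v \<Rightarrow> 'v"
  nrm :: "'v \<Rightarrow> real"

definition normed_space :: "('k::real_or_complex, 'v::ab_group_add) nspace \<Rightarrow> bool"
  where "normed_space X \<longleftrightarrow>
    vector_space (scale X) \<and> module.subspace (scale X) (carrier X) \<and>
    (\<forall>x\<in>carrier X. 0 \<le> nrm X x \<and> (nrm X x = 0 \<longleftrightarrow> x = 0)) \<and>
    (\<forall>c. \<forall>x\<in>carrier X. nrm X (scale X c x) = norm c * nrm X x) \<and>
    (\<forall>x\<in>carrier X. \<forall>y\<in>carrier X. nrm X (x + y) \<le> nrm X x + nrm X y)"

definition banach_space :: "('k::real_or_complex, 'v::ab_group_add) nspace \<Rightarrow> bool"
  where "banach_space X \<longleftrightarrow> normed_space X \<and>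
    (\<forall>s. (\<forall>n. s n \<in> carrier X) \<longrightarrow>
         (\<forall>e>0. \<exists>M. \<forall>m\<ge>M. \<forall>n\<ge>M. nrm X (s m - s n) < e) \<longrightarrow>
         (\<exists>l\<in>carrier X. (\<lambda>n. nrm X (s n - l)) \<longlonglongrightarrow> 0))"

lemma banach_space_class:
  "banach_space \<lparr>carrier = UNIV :: 'a::banach set, scale = scaleR, nrm = norm\<rparr>"
proof -
  have vs: "vector_space (scaleR :: real \<Rightarrow> 'a \<Rightarrow> 'a)"
    by (rule real_vector.vector_space_axioms)
  then have "module.subspace (scaleR :: real \<Rightarrow> 'a \<Rightarrow> 'a) UNIV"
    by (metis module.subspace_UNIV module_iff_vector_space)
  moreover have "\<exists>l. (\<lambda>n. norm (s n - l)) \<longlonglongrightarrow> 0"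
    if "\<forall>e>0. \<exists>M. \<forall>m\<ge>M. \<forall>n\<ge>M. norm (s m - s n) < e" for s :: "nat \<Rightarrow> 'a"
  proof -
    from that have "Cauchy s" by (auto intro: CauchyI)
    then obtain l where "s \<longlonglongrightarrow> l" using Cauchy_convergent convergentD by blast
    then show ?thesis using LIM_zero tendsto_norm_zero by blast
  qed
  ultimately show ?thesis
    using vs by (simp add: banach_space_def normed_space_def norm_triangle_ineq)
qed

definition bounded_operator ::
  "('k::real_or_complex, 'v::ab_group_add) nspace \<Rightarrow> ('k, 'w::ab_group_add) nspace \<Rightarrow>
   ('v \<Rightarrow> 'w) \<Rightarrow> bool"
  where "bounded_operator X Y A \<longleftrightarrow>
    (\<forall>x\<in>carrier X. A x \<in> carrier Y) \<and>
    (\<forall>x\<in>carrier X. \<forall>y\<in>carrier X. A (x + y) = A x + A y) \<and>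
    (\<forall>c. \<forall>x\<in>carrier X. A (scale X c x) = scale Y c (A x)) \<and>
    (\<exists>C. \<forall>x\<in>carrier X. nrm Y (A x) \<le> C * nrm X x)"

definition scalar_space :: "('k::real_or_complex, 'k) nspace"
  where "scalar_space = \<lparr>carrier = UNIV, scale = (*), nrm = norm\<rparr>"

definition dual :: "('k::real_or_complex, 'v::ab_group_add) nspace \<Rightarrow> ('v \<Rightarrow> 'k) set"
  where "dual X = {f. bounded_operator X scalar_space f}"

definition dual_ball :: "('k::real_or_complex, 'v::ab_group_add) nspace \<Rightarrow> ('v \<Rightarrow> 'k) set"
  where "dual_ball X = {f \<in> dual X. \<forall>x\<in>carrier X. norm (f x) \<le> nrm X x}"

section \<open>Weak nullity and complete continuity\<close>

definition sequence_in :: "('k, 'v) nspace \<Rightarrow> (nat \<Rightarrow> 'v) \<Rightarrow> bool"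
  where "sequence_in X x \<longleftrightarrow> (\<forall>n\<ge>1. x n \<in> carrier X)"

definition norm_null :: "('k, 'v) nspace \<Rightarrow> (nat \<Rightarrow> 'v) \<Rightarrow> bool"
  where "norm_null X x \<longleftrightarrow> (\<lambda>n. nrm X (x n)) \<longlonglongrightarrow> 0"

definition weakly_null ::
  "('k::real_or_complex, 'v::ab_group_add) nspace \<Rightarrow> (nat \<Rightarrow> 'v) \<Rightarrow> bool"
  where "weakly_null X x \<longleftrightarrow> (\<forall>f\<in>dual X. (\<lambda>n. f (x n)) \<longlonglongrightarrow> 0)"

definition large_sets ::
  "('k::real_or_complex, 'v::ab_group_add) nspace \<Rightarrow> real \<Rightarrow> (nat \<Rightarrow> 'v) \<Rightarrow> nat set set"
  where "large_sets X \<epsilon> x = {{}} \<union>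
    {F. finite F \<and> F \<subseteq> {1..} \<and> (\<exists>f\<in>dual_ball X. \<forall>n\<in>F. norm (f (x n)) \<ge> \<epsilon>)}"

fun ord_weakly_null ::
  "(countable_ordinal \<Rightarrow> nat set set) \<Rightarrow> ordinal \<Rightarrow>
   ('k::real_or_complex, 'v::ab_group_add) nspace \<Rightarrow> (nat \<Rightarrow> 'v) \<Rightarrow> bool" where
  "ord_weakly_null S (Ctbl \<xi>) X x \<longleftrightarrow>
     \<not> (\<exists>\<epsilon>>0. \<exists>N. infinite N \<and> N \<subseteq> {1..} \<and> spread (S \<xi>) N \<subseteq> large_sets X \<epsilon> x)"
| "ord_weakly_null S Omega1 X x \<longleftrightarrow> weakly_null X x"

text \<open>
  An operator is a triple of domain, codomain and map. The values of the map outside the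
  domain are irrelevant to all notions below.
\<close>

type_synonym ('k, 'v, 'w) operator =
  "('k, 'v) nspace \<times> ('k, 'w) nspace \<times> ('v \<Rightarrow> 'w)"

definition operators :: "('k::real_or_complex, 'v::ab_group_add, 'w::ab_group_add) operator set"
  where "operators = {(X, Y, A). banach_space X \<and> banach_space Y \<and> bounded_operator X Y A}"

definition cc_operators :: "('k::real_or_complex, 'v::ab_group_add, 'w::ab_group_add) operator set"
  where "cc_operators = {(X, Y, A) \<in> operators.
    \<forall>x. sequence_in X x \<longrightarrow> weakly_null X x \<longrightarrow> norm_null Y (\<lambda>n. A (x n))}"

definition ord_cc_operators ::
  "(countable_ordinal \<Rightarrow> nat set set) \<Rightarrow> ordinal \<Rightarrow>
   ('k::real_or_complex, 'v::ab_group_add, 'w::ab_group_add) operator set"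
  where "ord_cc_operators S \<xi> = {(X, Y, A) \<in> operators.
    \<forall>x. sequence_in X x \<longrightarrow> ord_weakly_null S \<xi> X x \<longrightarrow> norm_null Y (\<lambda>n. A (x n))}"

definition v_index ::
  "(countable_ordinal \<Rightarrow> nat set set) \<Rightarrow>
   ('k::real_or_complex, 'v::ab_group_add, 'w::ab_group_add) operator \<Rightarrow> ordinal"
  where "v_index S T =
    (if \<exists>\<xi>. T \<notin> ord_cc_operators S (Ctbl \<xi>)
     then Ctbl (LEAST \<xi>. T \<notin> ord_cc_operators S (Ctbl \<xi>))
     else Omega1)"

end

theory Submission
  imports Defs
begin

text \<open>
  The first identity holds by definition. The second one says that \<open>0\<close>-weakly null sequences are
  norm null: \<open>S 0\<close> contains only singletons and the empty set, and every vector has a norming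
  functional by the Hahn-Banach theorem (\<open>norming_functional\<close>). The inclusions between the classes
  hold because the notion of \<open>\<xi>\<close>-weak nullity gets weaker as \<open>\<xi>\<close> grows
  (\<open>ord_weakly_null_mono\<close>): for \<open>\<xi> \<le> \<zeta>\<close>, the members of \<open>S \<xi>\<close> far enough out belong to \<open>S \<zeta>\<close>,
  and a functional that does not tend to zero along a sequence is large on an infinite set of
  indices.

  For \<open>0 < \<xi> < \<omega>\<^sub>1\<close>, let \<open>(\<eta>\<^sub>n)\<close> enumerate the ordinals below \<open>\<xi>\<close>, and let \<open>X\<close> be the space of
  scalar null sequences \<open>x\<close> for which the norm
  \<open>max (sup\<^sub>i \<bar>x i\<bar>) (sup { 1/(n+1) (\<Sum>i\<in>F. \<bar>x i\<bar>) | n F. F \<in> S \<eta>\<^sub>n })\<close> is finite. The operator is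
  the inclusion of \<open>X\<close> into the null sequences with the supremum norm.

  It is not \<open>\<xi>\<close>-completely continuous. The unit vectors are mapped to unit vectors, and they are
  \<open>\<xi>\<close>-weakly null in \<open>X\<close> because, for each \<open>\<theta> < \<xi>\<close> and each infinite \<open>N\<close>, some member of
  \<open>S (\<theta> + 1)(N)\<close> carries a probability measure that is uniformly small on the members of \<open>S \<theta>\<close>
  (\<open>repeated_averages\<close>). With \<open>\<theta>\<close> the largest of finitely many \<open>\<eta>\<^sub>n\<close>, the corresponding averages of
  unit vectors have small norm.

  It is \<open>\<eta>\<^sub>n\<close>-completely continuous for every \<open>n\<close>. A weakly null sequence in \<open>X\<close> whose supremum
  norms do not tend to zero has a subsequence that is, up to small errors, separated by coordinates
  (\<open>gliding_hump\<close>), and the sums of these coordinates over members of \<open>S \<eta>\<^sub>n\<close> are bounded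
  functionals, which show that the sequence is not \<open>\<eta>\<^sub>n\<close>-weakly null.

  So this operator has index \<open>\<xi>\<close>, and applying this to \<open>\<xi> + 1\<close> shows that the inclusions are
  strict.
\<close>

section \<open>Countable ordinals\<close>

lemma zero_le_countable_ordinal: "0 \<le> (x :: countable_ordinal)"
  unfolding zero_countable_ordinal_def by (rule Least_le) simp

lemma ord_succ_le_iff: "ord_succ x \<le> y \<longleftrightarrow> x < y"
  using less_ord_succ[of x] by (auto simp: ord_succ_def intro: Least_le less_le_trans)

lemma less_ord_succ_iff: "x < ord_succ y \<longleftrightarrow> x \<le> y"
  using ord_succ_le_iff[of y x] by (metis not_le)

lemma countable_ordinal_induct [case_names zero succ limit]:
  assumes "P 0"
    and "\<And>y. P y \<Longrightarrow> P (ord_succ y)"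
    and "\<And>x. ord_limit x \<Longrightarrow> (\<And>y. y < x \<Longrightarrow> P y) \<Longrightarrow> P x"
  shows "P (x :: countable_ordinal)"
proof (induction x rule: less_induct)
  case (less x)
  then show ?case using assms less_ord_succ unfolding ord_limit_def by metis
qed

section \<open>Schreier families\<close>

lemma nat_below_iff: "finite E \<Longrightarrow> nat_below n E \<longleftrightarrow> (\<forall>j\<in>E. n \<le> j)"
  unfolding nat_below_def by (cases "E = {}") auto

lemma set_below_iff:
  "finite E \<Longrightarrow> finite F \<Longrightarrow> set_below E F \<longleftrightarrow> (\<forall>a\<in>E. \<forall>b\<in>F. a < b)"
  unfolding set_below_def
  by (cases "E = {}"; cases "F = {}") (auto dest: order.strict_trans1 order.strict_trans2)

text \<open>
  \<open>A 1 < \<dots> < A n\<close> are nonempty members of \<open>F\<close> with \<open>n \<le> A 1\<close>: a witness that their union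
  belongs to \<open>schreier_next F\<close>. The order conditions are stated elementwise, which for finite sets
  agrees with the formulation through maxima and minima.
\<close>

definition schreier_partition :: "nat set set \<Rightarrow> nat \<Rightarrow> (nat \<Rightarrow> nat set) \<Rightarrow> bool" where
  "schreier_partition F n A \<longleftrightarrow> 1 \<le> n \<and> (\<forall>i\<in>{1..n}. A i \<noteq> {} \<and> A i \<in> F) \<and>
     (\<forall>j\<in>A 1. n \<le> j) \<and> (\<forall>i\<in>{1..<n}. \<forall>a\<in>A i. \<forall>b\<in>A (Suc i). a < b)"

lemma schreier_next_iff:
  assumes "\<And>E. E \<in> F \<Longrightarrow> finite E"
  shows "E \<in> schreier_next F \<longleftrightarrow>
    E = {} \<or> (\<exists>n A. schreier_partition F n A \<and> E = (\<Union>i\<in>{1..n}. A i))"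
proof -
  have *: "(1 \<le> n \<and> (\<forall>i\<in>{1..n}. A i \<noteq> {} \<and> A i \<in> F) \<and> nat_below n (A 1) \<and>
       (\<forall>i\<in>{1..<n}. set_below (A i) (A (Suc i)))) \<longleftrightarrow> schreier_partition F n A" for n A
  proof -
    have fin: "finite (A i)" if "\<forall>i\<in>{1..n}. A i \<noteq> {} \<and> A i \<in> F" "i \<in> {1..n}" for i
      using that assms by blast
    show ?thesis unfolding schreier_partition_def
      by (intro conj_cong refl ball_cong)
         (auto simp: nat_below_iff set_below_iff fin)
  qed
  show ?thesis
    unfolding schreier_next_def Un_iff mem_Collect_eq singleton_iff *[symmetric] by blast
qed

lemma schreier_partition_less:
  assumes "schreier_partition F n A" "1 \<le> i" "Suc i \<le> n" "a \<in> A i" "b \<in> A (Suc i)"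
  shows "a < b"
proof -
  have "i \<in> {1..<n}" using assms by simp
  then show ?thesis using assms unfolding schreier_partition_def by blast
qed

lemma schreier_partition_ge:
  assumes "schreier_partition F n A" "i \<in> {1..n}" "j \<in> A i"
  shows "n \<le> j"
proof -
  have "1 \<le> i" using assms(2) by simp
  then have "i \<le> n \<longrightarrow> (\<forall>j\<in>A i. n \<le> j)"
  proof (induction i rule: dec_induct)
    case base
    show ?case using assms(1) by (simp add: schreier_partition_def)
  next
    case (step i)
    show ?case
    proof (intro impI ballI)
      fix j assume i: "Suc i \<le> n" and j: "j \<in> A (Suc i)"
      then obtain a where "a \<in> A i"
        using assms(1) step.hyps unfolding schreier_partition_def
        by (metis atLeastAtMost_iff ex_in_conv Suc_leD)
      then have "n \<le> a" "a < j"
        using step i j schreier_partition_less[OF assms(1), of i a j] by auto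
      then show "n \<le> j" by simp
    qed
  qed
  then show ?thesis using assms by simp
qed

lemma sum_UN_le:
  fixes \<mu> :: "'a \<Rightarrow> real"
  assumes "finite I" "\<And>i. i \<in> I \<Longrightarrow> finite (A i)" "\<And>k. 0 \<le> \<mu> k"
  shows "sum \<mu> (\<Union>i\<in>I. A i) \<le> (\<Sum>i\<in>I. sum \<mu> (A i))"
  using assms(1,2)
proof (induction I rule: finite_induct)
  case (insert i I)
  have "sum \<mu> (A i \<union> (\<Union>i\<in>I. A i)) + sum \<mu> (A i \<inter> (\<Union>i\<in>I. A i)) = sum \<mu> (A i) + sum \<mu> (\<Union>i\<in>I. A i)"
    using insert by (intro sum.union_inter) auto
  moreover have "0 \<le> sum \<mu> (A i \<inter> (\<Union>i\<in>I. A i))" using assms(3) by (intro sum_nonneg)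
  ultimately show ?case using insert by auto
qed simp

locale schreier =
  fixes L :: "countable_ordinal \<Rightarrow> nat \<Rightarrow> countable_ordinal"
    and S :: "countable_ordinal \<Rightarrow> nat set set"
  assumes families: "schreier_families L S"
begin

lemma S_zero: "S 0 = schreier_zero"
  and S_succ: "S (ord_succ \<xi>) = schreier_next (S \<xi>)"
  using families unfolding schreier_families_def by auto

lemma
  assumes "ord_limit \<xi>"
  shows L_less: "1 \<le> n \<Longrightarrow> L \<xi> n < \<xi>"
    and L_cofinal: "\<eta> < \<xi> \<Longrightarrow> \<exists>n\<ge>1. \<eta> < L \<xi> n"
    and L_nested: "1 \<le> n \<Longrightarrow> S (ord_succ (L \<xi> n)) \<subseteq> S (L \<xi> (Suc n))"
    and S_limit: "S \<xi> = {E. finite E \<and> E \<subseteq> {1..} \<and>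
                 (\<exists>n\<ge>1. nat_below n E \<and> E \<in> S (ord_succ (L \<xi> n)))}"
  using families assms unfolding schreier_families_def by (blast, blast, blast, blast)

lemma L_succ_less: "ord_limit \<xi> \<Longrightarrow> 1 \<le> n \<Longrightarrow> ord_succ (L \<xi> n) < \<xi>"
proof -
  assume l: "ord_limit \<xi>" "1 \<le> n"
  have "L \<xi> n < L \<xi> (Suc n)"
    using families l unfolding schreier_families_def by (auto intro: strict_mono_onD)
  then have "ord_succ (L \<xi> n) \<le> L \<xi> (Suc n)" by (simp add: ord_succ_le_iff)
  also have "\<dots> < \<xi>" using L_less[OF l(1), of "Suc n"] by simp
  finally show ?thesis .
qed

lemma S_finite_pos: "E \<in> S \<xi> \<Longrightarrow> finite E \<and> E \<subseteq> {1..}"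
proof (induction \<xi> arbitrary: E rule: countable_ordinal_induct)
  case zero
  then show ?case by (simp add: S_zero schreier_zero_def)
next
  case (succ y)
  have fin: "\<And>E. E \<in> S y \<Longrightarrow> finite E" using succ.IH by blast
  show ?case
  proof (cases "E = {}")
    case False
    then obtain n A where A: "schreier_partition (S y) n A" "E = (\<Union>i\<in>{1..n}. A i)"
      using succ.prems schreier_next_iff[of "S y", OF fin] by (auto simp: S_succ)
    then have "finite (A i) \<and> A i \<subseteq> {1..}" if "i \<in> {1..n}" for i
      using that succ.IH[of "A i"] by (simp add: schreier_partition_def)
    then show ?thesis unfolding A(2) by blast
  qed simp
next
  case (limit x)
  then show ?case by (simp add: S_limit)
qed

lemma S_finite: "E \<in> S \<xi> \<Longrightarrow> finite E"
  and S_pos: "E \<in> S \<xi> \<Longrightarrow> k \<in> E \<Longrightarrow> 1 \<le> k"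
  using S_finite_pos by auto

lemma S_succ_iff:
  "E \<in> S (ord_succ \<xi>) \<longleftrightarrow>
    E = {} \<or> (\<exists>n A. schreier_partition (S \<xi>) n A \<and> E = (\<Union>i\<in>{1..n}. A i))"
  unfolding S_succ by (rule schreier_next_iff) (rule S_finite)

lemma S_limit_iff:
  "ord_limit \<xi> \<Longrightarrow>
    E \<in> S \<xi> \<longleftrightarrow> (\<exists>n\<ge>1. (\<forall>j\<in>E. n \<le> j) \<and> E \<in> S (ord_succ (L \<xi> n)))"
  unfolding S_limit using S_finite_pos nat_below_iff by blast

lemma empty_in_S: "{} \<in> S \<xi>"
  by (induction \<xi> rule: countable_ordinal_induct)
     (auto simp: S_zero schreier_zero_def S_succ_iff S_limit_iff)

lemma S_subset_succ: "S \<xi> \<subseteq> S (ord_succ \<xi>)"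
proof
  fix E assume E: "E \<in> S \<xi>"
  show "E \<in> S (ord_succ \<xi>)"
  proof (cases "E = {}")
    case False
    then have "schreier_partition (S \<xi>) 1 (\<lambda>_. E)"
      using E S_pos unfolding schreier_partition_def by auto
    then show ?thesis unfolding S_succ_iff
      by (intro disjI2 exI[of _ 1] exI[of _ "\<lambda>_. E"]) simp
  qed (simp add: empty_in_S)
qed

text \<open>
  Schreier families are spreading. For a strictly increasing \<open>g\<close> one has \<open>k \<le> g k\<close>, so the
  conditions \<open>n \<le> E\<close> are preserved.
\<close>

lemma S_spread: "E \<in> S \<xi> \<Longrightarrow> strict_mono g \<Longrightarrow> g ` E \<in> S \<xi>"
proof (induction \<xi> arbitrary: E rule: countable_ordinal_induct)
  case zero
  then have "k \<le> g k" for k by (simp add: strict_mono_imp_increasing)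
  moreover have "card (g ` E) \<le> card E" using zero by (simp add: S_zero schreier_zero_def card_image_le)
  ultimately show ?case using zero
    by (auto simp: S_zero schreier_zero_def intro: order_trans)
next
  case (succ y)
  have g: "k \<le> g k" for k using succ.prems by (simp add: strict_mono_imp_increasing)
  have "E = {} \<or> (\<exists>n A. schreier_partition (S y) n A \<and> E = (\<Union>i\<in>{1..n}. A i))"
    using succ.prems S_succ_iff by blast
  then show ?case
  proof (elim disjE exE conjE)
    fix n A assume A: "schreier_partition (S y) n A" "E = (\<Union>i\<in>{1..n}. A i)"
    have "schreier_partition (S y) n (\<lambda>i. g ` A i)"
      using A(1) succ.IH succ.prems(2) order_trans[OF _ g]
      unfolding schreier_partition_def by (auto simp: strict_mono_less)
    moreover have "g ` E = (\<Union>i\<in>{1..n}. g ` A i)" using A(2) by auto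
    ultimately show ?thesis unfolding S_succ_iff by blast
  qed (simp add: empty_in_S)
next
  case (limit x)
  have g: "k \<le> g k" for k using limit.prems by (simp add: strict_mono_imp_increasing)
  obtain n where n: "n \<ge> 1" "\<forall>j\<in>E. n \<le> j" "E \<in> S (ord_succ (L x n))"
    using limit.prems S_limit_iff[OF limit.hyps] by blast
  have "g ` E \<in> S (ord_succ (L x n))"
    using limit.IH[OF L_succ_less[OF limit.hyps n(1)] n(3) limit.prems(2)] .
  then show ?case unfolding S_limit_iff[OF limit.hyps]
    using n order_trans[OF _ g] by (intro exI[of _ n]) auto
qed

text \<open>
  Tails of members are members. In the successor case the partition is cut at the first block \<open>A p\<close>
  that reaches \<open>m\<close>; dropping the blocks before it only lowers their number.
\<close>

lemma S_tail: "E \<in> S \<xi> \<Longrightarrow> E \<inter> {m..} \<in> S \<xi>"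
proof (induction \<xi> arbitrary: E rule: countable_ordinal_induct)
  case zero
  have "card (E \<inter> {m..}) \<le> card E"
    using zero by (intro card_mono) (auto simp: S_zero schreier_zero_def)
  then show ?case using zero by (auto simp: S_zero schreier_zero_def)
next
  case (succ y)
  show ?case
  proof (cases "E \<inter> {m..} = {}")
    case False
    then obtain n A where A: "schreier_partition (S y) n A" "E = (\<Union>i\<in>{1..n}. A i)"
      using succ.prems[unfolded S_succ_iff] by auto
    define P where "P p \<longleftrightarrow> p \<in> {1..n} \<and> A p \<inter> {m..} \<noteq> {}" for p
    have "\<exists>p. P p" using False A(2) unfolding P_def by blast
    define p where "p = (LEAST p. P p)"
    have p: "P p" and p_le: "\<And>i. P i \<Longrightarrow> p \<le> i"
      using LeastI_ex[OF \<open>\<exists>p. P p\<close>] Least_le unfolding p_def by blast+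
    define B where "B i = A (i + p - 1) \<inter> {m..}" for i
    have pn: "1 \<le> p" "p \<le> n" using p unfolding P_def by auto
    have ne: "A i \<inter> {m..} \<noteq> {}" if "p \<le> i" "i \<le> n" for i
      using that
    proof (induction i rule: dec_induct)
      case base
      then show ?case using p unfolding P_def by simp
    next
      case (step i)
      then have "A i \<inter> {m..} \<noteq> {}" by simp
      then obtain a where "a \<in> A i" "m \<le> a" by auto
      moreover have "A (Suc i) \<noteq> {}"
        using A(1) step unfolding schreier_partition_def by simp
      then obtain b where "b \<in> A (Suc i)" by blast
      moreover have "a < b"
        using schreier_partition_less[OF A(1) _ _ calculation(1,3)] step pn by simp
      ultimately show ?case by (auto intro: less_imp_le order_trans)
    qed
    have "schreier_partition (S y) (n - p + 1) B"
      unfolding schreier_partition_def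
    proof (intro conjI ballI)
      fix i assume "i \<in> {1..n - p + 1}"
      then have i: "p \<le> i + p - 1" "i + p - 1 \<le> n" using pn by auto
      show "B i \<noteq> {}" unfolding B_def by (rule ne[OF i])
      show "B i \<in> S y" unfolding B_def using A(1) i pn succ.IH
        unfolding schreier_partition_def by auto
    next
      fix j assume "j \<in> B 1"
      then have "n \<le> j" using schreier_partition_ge[OF A(1), of p j] pn by (auto simp: B_def)
      then show "n - p + 1 \<le> j" using pn by simp
    next
      fix i a b assume "i \<in> {1..<n - p + 1}" "a \<in> B i" "b \<in> B (Suc i)"
      moreover have "Suc i + p - 1 = Suc (i + p - 1)" using pn by simp
      ultimately show "a < b"
        using pn schreier_partition_less[OF A(1), of "i + p - 1" a b] unfolding B_def by auto
    qed simp
    moreover have "E \<inter> {m..} = (\<Union>i\<in>{1..n - p + 1}. B i)"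
    proof (intro set_eqI iffI)
      fix j assume j: "j \<in> E \<inter> {m..}"
      then obtain i where i: "i \<in> {1..n}" "j \<in> A i" using A(2) by blast
      then have "p \<le> i" using j by (intro p_le) (auto simp: P_def)
      then have "j \<in> B (i - p + 1)" "i - p + 1 \<in> {1..n - p + 1}" using i j pn by (auto simp: B_def)
      then show "j \<in> (\<Union>i\<in>{1..n - p + 1}. B i)" by blast
    next
      fix j assume "j \<in> (\<Union>i\<in>{1..n - p + 1}. B i)"
      then obtain i where i: "i \<in> {1..n - p + 1}" "j \<in> A (i + p - 1)" "m \<le> j"
        unfolding B_def by auto
      moreover from i(1) have "i + p - 1 \<in> {1..n}" using pn by auto
      ultimately show "j \<in> E \<inter> {m..}" using A(2) by auto
    qed
    ultimately show ?thesis unfolding S_succ_iff by blast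
  qed (simp add: empty_in_S)
next
  case (limit x)
  obtain n where n: "n \<ge> 1" "\<forall>j\<in>E. n \<le> j" "E \<in> S (ord_succ (L x n))"
    using limit.prems S_limit_iff[OF limit.hyps] by blast
  then have "E \<inter> {m..} \<in> S (ord_succ (L x n))"
    using limit.IH L_succ_less[OF limit.hyps] by blast
  then show ?case unfolding S_limit_iff[OF limit.hyps] using n by blast
qed

lemma S_eventually_mono:
  assumes "\<zeta> \<le> \<eta>"
  obtains m where "\<And>E. E \<in> S \<zeta> \<Longrightarrow> (\<forall>j\<in>E. m \<le> j) \<Longrightarrow> E \<in> S \<eta>"
proof -
  have "\<zeta> \<le> \<eta> \<Longrightarrow> \<exists>m. \<forall>E\<in>S \<zeta>. (\<forall>j\<in>E. m \<le> j) \<longrightarrow> E \<in> S \<eta>"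
  proof (induction \<eta> rule: countable_ordinal_induct)
    case zero
    then show ?case using zero_le_countable_ordinal[of \<zeta>] by auto
  next
    case (succ y)
    show ?case
    proof (cases "\<zeta> = ord_succ y")
      case False
      then have "\<zeta> \<le> y" using succ.prems less_ord_succ_iff[of \<zeta> y] le_neq_trans by blast
      then show ?thesis using succ.IH S_subset_succ by blast
    qed auto
  next
    case (limit x)
    show ?case
    proof (cases "\<zeta> = x")
      case False
      then obtain n where n: "n \<ge> 1" "\<zeta> < L x n"
        using L_cofinal[OF limit.hyps, of \<zeta>] le_neq_trans[OF limit.prems] by blast
      then obtain m where "\<forall>E\<in>S \<zeta>. (\<forall>j\<in>E. m \<le> j) \<longrightarrow> E \<in> S (L x n)"
        using limit.IH[OF L_less[OF limit.hyps n(1)] less_imp_le[OF n(2)]] by blast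
      then have "\<forall>E\<in>S \<zeta>. (\<forall>j\<in>E. max m n \<le> j) \<longrightarrow> E \<in> S x"
        unfolding S_limit_iff[OF limit.hyps] using n S_subset_succ[of "L x n"] by fastforce
      then show ?thesis by blast
    qed auto
  qed
  then show ?thesis using assms that by blast
qed

text \<open>
  A member of \<open>S \<theta>\<close>, \<open>\<theta>\<close> a limit, that has an element at most \<open>M\<close> comes from one of the
  first \<open>M\<close> families in the definition of \<open>S \<theta>\<close>, and these are nested.
\<close>

lemma S_limit_small_min:
  assumes l: "ord_limit \<theta>" and F: "F \<in> S \<theta>" and j: "j \<in> F" "j \<le> M"
  shows "F \<in> S (L \<theta> (Suc M))"
proof -
  obtain n where n: "n \<ge> 1" "\<forall>j\<in>F. n \<le> j" "F \<in> S (ord_succ (L \<theta> n))"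
    using F S_limit_iff[OF l] by blast
  have "n \<le> M" using n j by force
  then show ?thesis
  proof (induction M rule: dec_induct)
    case base
    show ?case using n L_nested[OF l] by blast
  next
    case (step M)
    then show ?case using L_nested[OF l, of "Suc M"] S_subset_succ by fastforce
  qed
qed

section \<open>Repeated averages\<close>

text \<open>
  \<open>\<mu>\<close> is a probability vector on \<open>E \<in> A\<close>, with \<open>M < E\<close>, whose image under \<open>g\<close> gives mass less
  than \<open>\<epsilon>\<close> to each member of \<open>P\<close>. It lives on indices: the set \<open>g ` E\<close> that carries the image
  measure then belongs to \<open>A(N)\<close> for \<open>N = g ` {1..}\<close>.
\<close>

definition index_average :: "nat set set \<Rightarrow> nat set set \<Rightarrow> (nat \<Rightarrow> nat) \<Rightarrow> nat \<Rightarrow> real \<Rightarrow>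
    nat set \<Rightarrow> (nat \<Rightarrow> real) \<Rightarrow> bool" where
  "index_average A P g M \<epsilon> E \<mu> \<longleftrightarrow> E \<in> A \<and> (\<forall>k\<in>E. M < k) \<and>
     (\<forall>k. 0 \<le> \<mu> k) \<and> (\<forall>k. k \<notin> E \<longrightarrow> \<mu> k = 0) \<and> sum \<mu> E = 1 \<and>
     (\<forall>F\<in>P. sum \<mu> {k\<in>E. g k \<in> F} < \<epsilon>)"

text \<open>
  Suppose that for each \<open>M\<close> there is an average that is small on those members of \<open>S \<theta>\<close> that meet
  \<open>{0..M}\<close>. Choose \<open>K\<close> such averages one after the other, each giving mass less than \<open>1/K\<close> to the
  members of \<open>S \<theta>\<close> that meet the initial segment of \<open>\<nat>\<close> used so far, and average them. For
  \<open>F \<in> S \<theta>\<close>, let \<open>i0\<close> be the first block that \<open>F\<close> meets: the blocks before it contribute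
  nothing, the block \<open>i0\<close> at most \<open>1\<close>, and each later one at most \<open>1/K\<close>, so that \<open>F\<close> has mass at most \<open>2/K\<close>.
\<close>

lemma average_of_averages:
  assumes g: "strict_mono g" and "0 < \<epsilon>"
    and Q: "\<And>M \<epsilon>. 0 < \<epsilon> \<Longrightarrow>
        \<exists>E \<mu>. index_average (S \<theta>) {F\<in>S \<theta>. \<exists>j\<in>F. j \<le> M} g M \<epsilon> E \<mu>"
  shows "\<exists>E \<mu>. index_average (S (ord_succ \<theta>)) (S \<theta>) g M \<epsilon> E \<mu>"
proof -
  obtain K where K: "2 / \<epsilon> < real K" using reals_Archimedean2 by blast
  then have K0: "0 < K" using \<open>0 < \<epsilon>\<close> by (metis divide_pos_pos of_nat_0_less_iff order_less_trans zero_less_numeral)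
  have K2: "2 / real K < \<epsilon>" using K K0 \<open>0 < \<epsilon>\<close> by (simp add: field_simps)
  let ?Q = "\<lambda>M. index_average (S \<theta>) {F\<in>S \<theta>. \<exists>j\<in>F. j \<le> M} g M (1 / real K)"
  have ex: "\<exists>p. ?Q m (fst p) (snd p)" for m
    using Q[of "1 / real K" m] K0 by simp
  \<comment> \<open>The first block starts beyond \<open>K\<close>, as a union of \<open>K\<close> blocks in \<open>schreier_next\<close> must.\<close>
  have "\<exists>p. \<forall>n. (n = 0 \<longrightarrow> ?Q (max M K) (fst (p n)) (snd (p n))) \<and>
     ?Q (g (Max (fst (p n)))) (fst (p (Suc n))) (snd (p (Suc n)))"
    using ex by (intro dependent_nat_choice) auto
  then obtain p where p: "\<forall>n. (n = 0 \<longrightarrow> ?Q (max M K) (fst (p n)) (snd (p n))) \<and>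
     ?Q (g (Max (fst (p n)))) (fst (p (Suc n))) (snd (p (Suc n)))" by blast
  define E where "E n = fst (p n)" for n
  define \<mu> where "\<mu> n = snd (p n)" for n
  have E0: "?Q (max M K) (E 0) (\<mu> 0)" and ES: "\<And>i. ?Q (g (Max (E i))) (E (Suc i)) (\<mu> (Suc i))"
    using p by (simp_all add: E_def \<mu>_def)
  have avg: "\<exists>m. ?Q m (E n) (\<mu> n)" for n using E0 ES by (cases n) auto
  have ES\<theta>: "E n \<in> S \<theta>" and \<mu>0: "0 \<le> \<mu> n k" and \<mu>_out: "k \<notin> E n \<Longrightarrow> \<mu> n k = 0"
    and \<mu>1: "sum (\<mu> n) (E n) = 1" for n k
    using avg[of n] unfolding index_average_def by auto
  have fin: "finite (E n)" for n using ES\<theta> S_finite by blast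
  have ne: "E n \<noteq> {}" for n using \<mu>1[of n] by auto
  have g_ge: "k \<le> g k" for k using g by (simp add: strict_mono_imp_increasing)
  have step: "g (Max (E i)) < b" if "b \<in> E (Suc i)" for i b
    using ES[of i] that unfolding index_average_def by auto
  have Max_mono: "g (Max (E i)) \<le> g (Max (E j))" if "i \<le> j" for i j
    using that
  proof (induction j rule: dec_induct)
    case (step n)
    have "Max (E (Suc n)) \<in> E (Suc n)" using fin ne by simp
    then have "g (Max (E n)) < Max (E (Suc n))" using \<open>\<And>i b. b \<in> E (Suc i) \<Longrightarrow> g (Max (E i)) < b\<close> by blast
    then show ?case using step g_ge[of "Max (E (Suc n))"] by simp
  qed simp
  have far: "g a < b" if "a \<in> E i" "b \<in> E j" "i < j" for a b i j
  proof -
    obtain j' where j': "j = Suc j'" "i \<le> j'" using \<open>i < j\<close> by (cases j) auto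
    have "g a \<le> g (Max (E i))" using that(1) fin g by (simp add: strict_mono_less_eq)
    also have "\<dots> \<le> g (Max (E j'))" using Max_mono j' by blast
    also have "\<dots> < b" using step that(2) j' by blast
    finally show ?thesis .
  qed
  have small: "sum (\<mu> j) {k\<in>E j. g k \<in> F} < 1 / real K"
    if "F \<in> S \<theta>" "a \<in> E i" "g a \<in> F" "i < j" for F a i j
  proof -
    obtain j' where j': "j = Suc j'" "i \<le> j'" using \<open>i < j\<close> by (cases j) auto
    have "g a \<le> g (Max (E i))" using that(2) fin g by (simp add: strict_mono_less_eq)
    also have "\<dots> \<le> g (Max (E j'))" using Max_mono j' by blast
    finally show ?thesis using ES[of j'] that j' unfolding index_average_def by auto
  qed
  \<comment> \<open>\<open>schreier_partition\<close> counts from \<open>1\<close>, the sequence of blocks from \<open>0\<close>.\<close>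
  define U where "U = (\<Union>i\<in>{1..K}. E (i - 1))"
  define \<nu> where "\<nu> k = (\<Sum>i<K. \<mu> i k) / real K" for k
  have U: "U = (\<Union>i<K. E i)"
  proof -
    have "U = (\<Union>i\<in>(\<lambda>i. i - 1) ` {1..K}. E i)" unfolding U_def by simp
    also have "(\<lambda>i. i - 1) ` {1..K} = {..<K}"
      by (auto simp: image_iff intro!: bexI[of _ "Suc _"])
    finally show ?thesis .
  qed
  have finU: "finite U" using fin unfolding U by simp
  have U_mass: "sum \<nu> {k\<in>U. k \<in> B} = (\<Sum>i<K. sum (\<mu> i) {k\<in>E i. k \<in> B}) / real K" for B
  proof -
    have "sum \<nu> {k\<in>U. k \<in> B} = (\<Sum>i<K. sum (\<mu> i) {k\<in>U. k \<in> B}) / real K"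
      unfolding \<nu>_def sum_divide_distrib[symmetric] by (subst sum.swap) simp
    also have "(\<Sum>i<K. sum (\<mu> i) {k\<in>U. k \<in> B}) = (\<Sum>i<K. sum (\<mu> i) {k\<in>E i. k \<in> B})"
      by (intro sum.cong refl sum.mono_neutral_right) (use finU \<mu>_out in \<open>auto simp: U\<close>)
    finally show ?thesis .
  qed
  have "index_average (S (ord_succ \<theta>)) (S \<theta>) g M \<epsilon> U \<nu>"
    unfolding index_average_def
  proof (intro conjI allI impI ballI)
    have first: "K \<le> j" "M < j" if "j \<in> E 0" for j
      using E0 that unfolding index_average_def by auto
    have "schreier_partition (S \<theta>) K (\<lambda>i. E (i - 1))"
      unfolding schreier_partition_def
    proof (intro conjI ballI)
      fix i a b assume "i \<in> {1..<K}" "a \<in> E (i - 1)" "b \<in> E (Suc i - 1)"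
      then have "g a < b" by (intro far[of a "i - 1" b i]) auto
      then show "a < b" using g_ge[of a] by simp
    qed (use K0 ne ES\<theta> first in auto)
    then show "U \<in> S (ord_succ \<theta>)" unfolding S_succ_iff U_def by blast
    fix k assume "k \<in> U"
    then obtain i where i: "k \<in> E i" unfolding U by blast
    show "M < k"
    proof (cases "i = 0")
      case False
      obtain a where "a \<in> E 0" using ne by blast
      then show ?thesis using far[of a 0 k i] first[of a] g_ge[of a] i False by simp
    qed (use i first in simp)
  next
    show "0 \<le> \<nu> k" for k using \<mu>0 by (simp add: \<nu>_def sum_nonneg)
    show "\<nu> k = 0" if "k \<notin> U" for k using that \<mu>_out by (auto simp: \<nu>_def U intro!: sum.neutral)
    show "sum \<nu> U = 1" using U_mass[of UNIV] \<mu>1 K0 by simp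
  next
    fix F assume F: "F \<in> S \<theta>"
    let ?m = "\<lambda>i. sum (\<mu> i) {k\<in>E i. k \<in> g -` F}"
    have "(\<Sum>i<K. ?m i) \<le> 2"
    proof (cases "\<exists>i. i < K \<and> (\<exists>a\<in>E i. g a \<in> F)")
      case True
      define i0 where "i0 = (LEAST i. i < K \<and> (\<exists>a\<in>E i. g a \<in> F))"
      have i0: "i0 < K" "\<exists>a\<in>E i0. g a \<in> F" using LeastI_ex[OF True] unfolding i0_def by auto
      then obtain a where a: "a \<in> E i0" "g a \<in> F" by blast
      have before: "{k\<in>E i. k \<in> g -` F} = {}" if "i < i0" for i
        using not_less_Least[of i "\<lambda>i. i < K \<and> (\<exists>a\<in>E i. g a \<in> F)"] that i0(1)
        unfolding i0_def by auto
      have le: "?m i \<le> 1 / real K + (if i = i0 then 1 else 0)" for i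
      proof (cases i i0 rule: linorder_cases)
        case less
        then show ?thesis unfolding before[OF less] by simp
      next
        case equal
        have "?m i \<le> sum (\<mu> i) (E i)" using fin \<mu>0 by (intro sum_mono2) auto
        then have "?m i \<le> 1" unfolding \<mu>1 .
        then show ?thesis using equal by (simp add: add_increasing)
      next
        case greater
        then show ?thesis using small[OF F a greater] by simp
      qed
      have "(\<Sum>i<K. ?m i) \<le> (\<Sum>i<K. 1 / real K + (if i = i0 then 1 else 0))"
        by (intro sum_mono le)
      also have "\<dots> = 2" using i0(1) K0 by (simp add: sum.distrib)
      finally show ?thesis .
    next
      case False
      then have "{k\<in>E i. k \<in> g -` F} = {}" if "i < K" for i using that by auto
      then have "(\<Sum>i<K. ?m i) = 0" by (intro sum.neutral) (metis lessThan_iff sum.empty)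
      then show ?thesis by linarith
    qed
    then have "sum \<nu> {k\<in>U. k \<in> g -` F} \<le> 2 / real K"
      unfolding U_mass by (intro divide_right_mono) auto
    then show "sum \<nu> {k\<in>U. g k \<in> F} < \<epsilon>" using K2 by simp
  qed
  then show ?thesis by blast
qed

text \<open>
  For each infinite \<open>N\<close>, a member of \<open>S (\<theta> + 1)(N)\<close> carries a probability measure that is
  uniformly small on \<open>S \<theta>\<close>. By \<open>average_of_averages\<close> it suffices to produce, by induction on \<open>\<theta>\<close>,
  averages on members of \<open>S \<theta>(N)\<close> that are small on the members of \<open>S \<theta>\<close> with an element at
  most \<open>M\<close>. For \<open>\<theta> = 0\<close> any point beyond \<open>M\<close> will do. A member of \<open>S (y + 1)\<close> with an element at most \<open>M\<close> is a union of at most \<open>M\<close> members of \<open>S y\<close>. For a limit \<open>\<theta>\<close>, the sets in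
  question all belong to a single family of smaller index.
\<close>

lemma repeated_averages:
  assumes "strict_mono g" "0 < \<epsilon>"
  shows "\<exists>E \<mu>. index_average (S (ord_succ \<theta>)) (S \<theta>) g M \<epsilon> E \<mu>"
  using assms
proof (induction \<theta> arbitrary: M \<epsilon> rule: countable_ordinal_induct)
  case zero
  have g: "k \<le> g k" for k using zero.prems by (simp add: strict_mono_imp_increasing)
  show ?case
  proof (rule average_of_averages[OF zero.prems])
    fix M :: nat and \<epsilon> :: real assume "0 < \<epsilon>"
    have single: "{Suc M} \<in> S 0" by (simp add: S_zero schreier_zero_def)
    have none: "{k \<in> {Suc M}. g k \<in> F} = {}" if "F \<in> S 0" "j \<in> F" "j \<le> M" for F j
    proof -
      have "F = {j}" using that by (auto simp: S_zero schreier_zero_def le_Suc_eq card_Suc_eq numeral_eq_Suc)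
      then show ?thesis using g[of "Suc M"] that by auto
    qed
    then have "sum (\<lambda>k. if k = Suc M then 1 else 0) {k \<in> {Suc M}. g k \<in> F} < \<epsilon>"
      if "F \<in> {F\<in>S 0. \<exists>j\<in>F. j \<le> M}" for F
    proof -
      have "{k \<in> {Suc M}. g k \<in> F} = {}" using that none by blast
      then show ?thesis using \<open>0 < \<epsilon>\<close> by (simp only: sum.empty)
    qed
    then have "index_average (S 0) {F\<in>S 0. \<exists>j\<in>F. j \<le> M} g M \<epsilon> {Suc M}
        (\<lambda>k. if k = Suc M then 1 else 0)"
      unfolding index_average_def using single by (intro conjI ballI) simp_all
    then show "\<exists>E \<mu>. index_average (S 0) {F\<in>S 0. \<exists>j\<in>F. j \<le> M} g M \<epsilon> E \<mu>" by blast
  qed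
next
  case (succ y)
  show ?case
  proof (rule average_of_averages[OF succ.prems])
    fix M :: nat and \<epsilon> :: real assume "0 < \<epsilon>"
    then obtain E \<mu> where E: "index_average (S (ord_succ y)) (S y) g M (\<epsilon> / (M + 1)) E \<mu>"
      using succ.IH[of "\<epsilon> / (M + 1)" M] succ.prems by auto
    then have finE: "finite E" and \<mu>: "\<And>k. 0 \<le> \<mu> k" 
      and mass: "\<And>F. F \<in> S y \<Longrightarrow> sum \<mu> {k\<in>E. g k \<in> F} < \<epsilon> / (M + 1)"
      using S_finite unfolding index_average_def by auto
    have "sum \<mu> {k\<in>E. g k \<in> F} < \<epsilon>" if F: "F \<in> S (ord_succ y)" "j \<in> F" "j \<le> M" for F j
    proof -
      obtain n A where A: "schreier_partition (S y) n A" "F = (\<Union>i\<in>{1..n}. A i)"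
        using F(2) F(1)[unfolded S_succ_iff] by auto
      obtain i where "i \<in> {1..n}" "j \<in> A i" using F(2) A(2) by blast
      then have n: "n \<le> M" using schreier_partition_ge[OF A(1), of i j] F(3) by simp
      have split: "{k\<in>E. g k \<in> F} = (\<Union>i\<in>{1..n}. {k\<in>E. g k \<in> A i})" using A(2) by auto
      have "sum \<mu> {k\<in>E. g k \<in> F} \<le> (\<Sum>i\<in>{1..n}. sum \<mu> {k\<in>E. g k \<in> A i})"
        unfolding split using finE \<mu> by (intro sum_UN_le) auto
      also have "\<dots> \<le> (\<Sum>i\<in>{1..n}. \<epsilon> / (M + 1))"
      proof (rule sum_mono)
        fix i assume "i \<in> {1..n}"
        then have "A i \<in> S y" using A(1) unfolding schreier_partition_def by blast
        from mass[OF this] show "sum \<mu> {k\<in>E. g k \<in> A i} \<le> \<epsilon> / (M + 1)" by (rule less_imp_le)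
      qed
      also have "\<dots> \<le> M * (\<epsilon> / (M + 1))" using n \<open>0 < \<epsilon>\<close> by (simp add: divide_right_mono)
      also have "\<dots> < \<epsilon>" using \<open>0 < \<epsilon>\<close> by (simp add: field_simps)
      finally show ?thesis .
    qed
    then show "\<exists>E \<mu>. index_average (S (ord_succ y)) {F\<in>S (ord_succ y). \<exists>j\<in>F. j \<le> M} g M \<epsilon> E \<mu>"
      using E unfolding index_average_def by blast
  qed
next
  case (limit x)
  show ?case
  proof (rule average_of_averages[OF limit.prems])
    fix M :: nat and \<epsilon> :: real assume "0 < \<epsilon>"
    let ?y = "L x (Suc M)"
    obtain E \<mu> where E: "index_average (S (ord_succ ?y)) (S ?y) g (Suc M) \<epsilon> E \<mu>"
      using limit.IH[OF L_less[OF limit.hyps] limit.prems(1) \<open>0 < \<epsilon>\<close>, of "Suc M" "Suc M"] by auto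
    then have "E \<in> S x" unfolding S_limit_iff[OF limit.hyps]
      by (intro exI[of _ "Suc M"]) (auto simp: index_average_def less_imp_le)
    then have "index_average (S x) {F\<in>S x. \<exists>j\<in>F. j \<le> M} g M \<epsilon> E \<mu>"
      using E S_limit_small_min[OF limit.hyps] unfolding index_average_def
      by (auto intro: Suc_lessD)
    then show "\<exists>E \<mu>. index_average (S x) {F\<in>S x. \<exists>j\<in>F. j \<le> M} g M \<epsilon> E \<mu>" by blast
  qed
qed

end

section \<open>Norming functionals\<close>

text \<open>
  Sublinear functionals on the subspace \<open>V\<close>. They vanish outside \<open>V\<close>, so that the pointwise order
  compares them on \<open>V\<close> only and minimal ones can exist.
\<close>

definition sublinear_on :: "(real \<Rightarrow> 'v::ab_group_add \<Rightarrow> 'v) \<Rightarrow> 'v set \<Rightarrow> ('v \<Rightarrow> real) \<Rightarrow> bool" where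
  "sublinear_on sc V q \<longleftrightarrow> (\<forall>x\<in>V. \<forall>y\<in>V. q (x + y) \<le> q x + q y) \<and>
     (\<forall>c\<ge>0. \<forall>x\<in>V. q (sc c x) = c * q x) \<and> (\<forall>x. x \<notin> V \<longrightarrow> q x = 0)"

locale real_subspace = vector_space sc for sc :: "real \<Rightarrow> 'v::ab_group_add \<Rightarrow> 'v" +
  fixes V :: "'v set"
  assumes sub: "subspace V"
begin

lemma sublinear_zero: "sublinear_on sc V q \<Longrightarrow> q 0 = 0"
  using subspace_0[OF sub] unfolding sublinear_on_def
  by (metis mult_zero_left order_refl scale_zero_left)

lemma sublinear_neg: "sublinear_on sc V q \<Longrightarrow> x \<in> V \<Longrightarrow> - q (- x) \<le> q x"
proof -
  assume q: "sublinear_on sc V q" and x: "x \<in> V"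
  then have "q (x + - x) \<le> q x + q (- x)"
    using subspace_neg[OF sub x] unfolding sublinear_on_def by blast
  then show ?thesis using sublinear_zero[OF q] by simp
qed

text \<open>
  A sublinear functional below \<open>q\<close> that is at most \<open>- q a\<close> at \<open>- a\<close> (take \<open>t = 1\<close>). A sublinear
  functional that cannot be lowered in any direction is therefore odd, hence linear.
\<close>

definition lowered :: "('v \<Rightarrow> real) \<Rightarrow> 'v \<Rightarrow> 'v \<Rightarrow> real" where
  "lowered q a x = (if x \<in> V then INF t\<in>{0..}. q (x + sc t a) - t * q a else 0)"

lemma
  assumes q: "sublinear_on sc V q" and a: "a \<in> V"
  shows sublinear_lowered: "sublinear_on sc V (lowered q a)"
    and lowered_le: "x \<in> V \<Longrightarrow> t \<ge> 0 \<Longrightarrow> lowered q a x \<le> q (x + sc t a) - t * q a"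
proof -
  have qadd: "q (x + y) \<le> q x + q y" if "x \<in> V" "y \<in> V" for x y
    using q that unfolding sublinear_on_def by blast
  have qsc: "q (sc c x) = c * q x" if "x \<in> V" "c \<ge> 0" for c x
    using q that unfolding sublinear_on_def by blast
  have V: "x + sc t a \<in> V" if "x \<in> V" for x t
    using that a sub by (simp add: subspace_add subspace_scale)
  have low: "- q (- x) \<le> q (x + sc t a) - t * q a" if "x \<in> V" "t \<ge> 0" for x t
  proof -
    have "q (sc t a) \<le> q (x + sc t a) + q (- x)"
      using qadd[OF V[OF that(1), of t] subspace_neg[OF sub that(1)]] by (simp add: algebra_simps)
    then show ?thesis using qsc[OF a that(2)] by simp
  qed
  have bdd: "bdd_below ((\<lambda>t. q (x + sc t a) - t * q a) ` {0..})" if "x \<in> V" for x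
    using low[OF that] by (intro bdd_belowI2[where m = "- q (- x)"]) auto
  have le: "lowered q a x \<le> q (x + sc t a) - t * q a" if "x \<in> V" "t \<ge> 0" for x t
    unfolding lowered_def using that bdd by (auto intro!: cINF_lower)
  have ge: "m \<le> lowered q a x" if "x \<in> V" "\<And>t. t \<ge> 0 \<Longrightarrow> m \<le> q (x + sc t a) - t * q a" for x m
    unfolding lowered_def using that by (auto intro!: cINF_greatest)
  show "x \<in> V \<Longrightarrow> t \<ge> 0 \<Longrightarrow> lowered q a x \<le> q (x + sc t a) - t * q a" by (rule le)
  have scale_le: "lowered q a (sc c x) \<le> c * lowered q a x" if x: "x \<in> V" and c: "c > 0" for c x
  proof -
    have "lowered q a (sc c x) / c \<le> lowered q a x"
    proof (rule ge[OF x])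
      fix t :: real assume t: "t \<ge> 0"
      have "lowered q a (sc c x) \<le> q (sc c x + sc (c * t) a) - c * t * q a"
        using x c t sub by (intro le) (auto simp: subspace_scale)
      also have "sc c x + sc (c * t) a = sc c (x + sc t a)" by (simp add: scale_right_distrib)
      also have "q \<dots> = c * q (x + sc t a)" using qsc V x c by simp
      finally show "lowered q a (sc c x) / c \<le> q (x + sc t a) - t * q a"
        using c by (simp add: field_simps)
    qed
    then show ?thesis using c by (simp add: field_simps)
  qed
  have scale_eq: "lowered q a (sc c x) = c * lowered q a x" if x: "x \<in> V" and c: "c > 0" for c x
  proof (rule antisym[OF scale_le[OF x c]])
    have "lowered q a (sc (1 / c) (sc c x)) \<le> 1 / c * lowered q a (sc c x)"
      using x c sub by (intro scale_le) (auto simp: subspace_scale)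
    then show "c * lowered q a x \<le> lowered q a (sc c x)" using c by (simp add: field_simps)
  qed
  have zero: "lowered q a 0 = 0"
  proof (rule antisym)
    show "lowered q a 0 \<le> 0" using le[of 0 0] subspace_0[OF sub] sublinear_zero[OF q] by simp
    show "0 \<le> lowered q a 0" using qsc[OF a] by (intro ge subspace_0[OF sub]) simp
  qed
  show "sublinear_on sc V (lowered q a)"
    unfolding sublinear_on_def
  proof (intro conjI ballI allI impI)
    fix x y assume x: "x \<in> V" and y: "y \<in> V"
    then have xy: "x + y \<in> V" by (rule subspace_add[OF sub])
    have "lowered q a (x + y) - (q (x + sc s a) - s * q a) \<le> q (y + sc t a) - t * q a"
      if "s \<ge> 0" "t \<ge> 0" for s t
    proof -
      have "lowered q a (x + y) \<le> q (x + y + sc (s + t) a) - (s + t) * q a"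
        using that by (intro le xy) simp
      also have "x + y + sc (s + t) a = (x + sc s a) + (y + sc t a)"
        by (simp add: scale_left_distrib algebra_simps)
      also have "q \<dots> \<le> q (x + sc s a) + q (y + sc t a)" using x y V by (intro qadd) auto
      finally show ?thesis by (simp add: algebra_simps)
    qed
    then have "lowered q a (x + y) - (q (x + sc s a) - s * q a) \<le> lowered q a y" if "s \<ge> 0" for s
      using that by (intro ge[OF y]) auto
    then have "lowered q a (x + y) - lowered q a y \<le> lowered q a x"
      by (intro ge[OF x]) (simp add: algebra_simps)
    then show "lowered q a (x + y) \<le> lowered q a x + lowered q a y" by simp
  next
    fix c x assume "0 \<le> (c::real)" "x \<in> V"
    then show "lowered q a (sc c x) = c * lowered q a x"
      using scale_eq zero by (cases "c = 0") auto
  qed (simp add: lowered_def)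
qed

text \<open>
  By Zorn's lemma there is a minimal sublinear functional below \<open>lowered p x0\<close>, and it is linear.
  Starting from \<open>lowered p x0\<close> instead of \<open>p\<close> forces the value \<open>p x0\<close> at \<open>x0\<close>.
\<close>

lemma hahn_banach:
  assumes p: "sublinear_on sc V p" and x0: "x0 \<in> V"
  shows "\<exists>u. (\<forall>x\<in>V. \<forall>y\<in>V. u (x + y) = u x + u y) \<and> (\<forall>c. \<forall>x\<in>V. u (sc c x) = c * u x) \<and>
    (\<forall>x\<in>V. u x \<le> p x) \<and> u x0 = p x0"
proof -
  define p0 where "p0 = lowered p x0"
  have p0: "sublinear_on sc V p0" unfolding p0_def by (rule sublinear_lowered[OF p x0])
  have p0p: "p0 x \<le> p x" if "x \<in> V" for x
    using lowered_le[OF p x0 that, of 0] by (simp add: p0_def)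
  define A where "A = {q. sublinear_on sc V q \<and> q \<le> p0}"
  have "\<exists>m\<in>A. \<forall>q\<in>A. q \<le> m \<longrightarrow> q = m"
  proof (rule predicate_Zorn[of A "\<lambda>q r. r \<le> q"])
    show "partial_order_on A (relation_of (\<lambda>q r. r \<le> q) A)"
      by (rule partial_order_on_relation_ofI) auto
  next
    fix C assume C: "C \<in> Chains (relation_of (\<lambda>q r. r \<le> q) A)"
    then have CA: "C \<subseteq> A" and chain: "\<And>q r. q \<in> C \<Longrightarrow> r \<in> C \<Longrightarrow> q \<le> r \<or> r \<le> q"
      unfolding Chains_def relation_of_def by blast+
    show "\<exists>u\<in>A. \<forall>q\<in>C. u \<le> q"
    proof (cases "C = {}")
      case True
      then show ?thesis using p0 unfolding A_def by auto
    next
      case False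
      have sl: "sublinear_on sc V q" "q \<le> p0" if "q \<in> C" for q
        using that CA unfolding A_def by auto
      define m where "m x = (INF q\<in>C. q x)" for x
      have low: "- p0 (- x) \<le> q x" if "q \<in> C" "x \<in> V" for q x
        using sublinear_neg[OF sl(1)[OF that(1)] that(2)] sl(2)[OF that(1)]
        by (smt (verit) le_fun_def)
      have bdd: "bdd_below ((\<lambda>q. q x) ` C)" for x
      proof (cases "x \<in> V")
        case True
        then show ?thesis using low by (intro bdd_belowI2[where m = "- p0 (- x)"]) auto
      next
        case False
        then have "q x = 0" if "q \<in> C" for q using sl(1)[OF that] unfolding sublinear_on_def by blast
        then show ?thesis by (intro bdd_belowI2[where m = 0]) (metis order_refl)
      qed
      have le: "m x \<le> q x" if "q \<in> C" for q x
        unfolding m_def by (rule cINF_lower[OF bdd that])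
      have ge: "b \<le> m x" if "\<And>q. q \<in> C \<Longrightarrow> b \<le> q x" for b x
        unfolding m_def by (rule cINF_greatest[OF False that])
      have "sublinear_on sc V m"
        unfolding sublinear_on_def
      proof (intro conjI ballI allI impI)
        fix x y assume x: "x \<in> V" and y: "y \<in> V"
        have *: "m (x + y) - q x \<le> r y" if qr: "q \<in> C" "r \<in> C" for q r
        proof -
          obtain s where s: "s \<in> C" "s \<le> q" "s \<le> r" using chain[OF qr] qr by blast
          have "m (x + y) \<le> s (x + y)" by (rule le[OF s(1)])
          also have "\<dots> \<le> s x + s y" using sl(1)[OF s(1)] x y unfolding sublinear_on_def by blast
          also have "\<dots> \<le> q x + r y" using s by (intro add_mono) (auto simp: le_fun_def)
          finally show ?thesis by simp
        qed
        then have "m (x + y) - q x \<le> m y" if "q \<in> C" for q using that by (intro ge)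
        then have "m (x + y) - m y \<le> m x" by (intro ge) (simp add: algebra_simps)
        then show "m (x + y) \<le> m x + m y" by simp
      next
        fix c :: real and x assume c: "0 \<le> c" and x: "x \<in> V"
        have sc: "q (sc c x) = c * q x" if "q \<in> C" for q
          using sl(1)[OF that] c x unfolding sublinear_on_def by blast
        show "m (sc c x) = c * m x"
        proof (rule antisym)
          show "c * m x \<le> m (sc c x)" using le c by (intro ge) (simp add: sc mult_left_mono)
          show "m (sc c x) \<le> c * m x"
          proof (cases "c = 0")
            case True
            obtain q where "q \<in> C" using False by blast
            then show ?thesis using le[of q "sc c x"] sc[of q] True by simp
          next
            case False
            then have "m (sc c x) / c \<le> m x"
              using le[of _ "sc c x"] c by (intro ge) (simp add: sc field_simps)
            then show ?thesis using False c by (simp add: field_simps)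
          qed
        qed
      next
        fix x assume "x \<notin> V"
        then have q0: "q x = 0" if "q \<in> C" for q
          using sl(1)[OF that] unfolding sublinear_on_def by blast
        obtain q where q: "q \<in> C" using False by blast
        have "m x \<le> 0" using le[OF q, of x] q0[OF q] by simp
        moreover have "0 \<le> m x" by (rule ge) (use q0 in force)
        ultimately show "m x = 0" by simp
      qed
      moreover have "m \<le> p0"
      proof -
        obtain q where "q \<in> C" using False by blast
        then show ?thesis using le sl(2) by (meson le_fun_def order_trans)
      qed
      ultimately have "m \<in> A" unfolding A_def by blast
      moreover have "m \<le> q" if "q \<in> C" for q using le[OF that] by (rule le_funI)
      ultimately show ?thesis by blast
    qed
  qed
  then obtain u where u: "u \<in> A" and minimal: "\<And>q. q \<in> A \<Longrightarrow> q \<le> u \<Longrightarrow> q = u" by blast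
  have us: "sublinear_on sc V u" and up: "u \<le> p0" using u unfolding A_def by auto
  have neg: "u (- a) = - u a" if a: "a \<in> V" for a
  proof -
    have "lowered u a x \<le> u x" for x
    proof (cases "x \<in> V")
      case True
      then show ?thesis using lowered_le[OF us a True, of 0] by simp
    next
      case False
      then show ?thesis using us by (simp add: lowered_def sublinear_on_def)
    qed
    then have "lowered u a \<le> u" by (simp add: le_fun_def)
    then have "lowered u a = u"
      using up sublinear_lowered[OF us a] by (intro minimal) (auto simp: A_def)
    then have "u (- a) \<le> u (- a + sc 1 a) - 1 * u a"
      using lowered_le[OF us a subspace_neg[OF sub a], of 1] by simp
    then have "u (- a) \<le> - u a" using sublinear_zero[OF us] by simp
    then show ?thesis using sublinear_neg[OF us a] by simp
  qed
  have uadd: "u (x + y) \<le> u x + u y" if "x \<in> V" "y \<in> V" for x y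
    using us that unfolding sublinear_on_def by blast
  have usc: "u (sc c x) = c * u x" if "x \<in> V" "c \<ge> 0" for c x
    using us that unfolding sublinear_on_def by blast
  show ?thesis
  proof (intro exI[of _ u] conjI ballI allI)
    fix x y assume x: "x \<in> V" and y: "y \<in> V"
    have "u (- x + - y) \<le> u (- x) + u (- y)" using x y by (intro uadd subspace_neg[OF sub])
    moreover have "- x + - y = - (x + y)" by simp
    ultimately have "u x + u y \<le> u (x + y)"
      using neg[OF x] neg[OF y] neg[OF subspace_add[OF sub x y]] by simp
    then show "u (x + y) = u x + u y" using uadd[OF x y] by simp
  next
    fix c x assume x: "x \<in> V"
    show "u (sc c x) = c * u x"
    proof (cases "c \<ge> 0")
      case False
      then have "u (sc (- c) x) = - c * u x" using usc[OF x, of "- c"] by simp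
      moreover have "u (sc (- c) x) = - u (sc c x)"
        using neg[OF subspace_scale[OF sub x, of c]] by simp
      ultimately show ?thesis by simp
    qed (use usc x in simp)
  next
    show "u x \<le> p x" if "x \<in> V" for x using that up p0p by (meson le_fun_def order_trans)
    have "u (- x0) \<le> p0 (- x0)" using up by (simp add: le_fun_def)
    also have "\<dots> \<le> p (- x0 + sc 1 x0) - 1 * p x0"
      unfolding p0_def by (rule lowered_le[OF p x0 subspace_neg[OF sub x0]]) simp
    also have "\<dots> = - p x0" using sublinear_zero[OF p] by simp
    finally have "p x0 \<le> u x0" using neg[OF x0] by simp
    moreover have "u x0 \<le> p x0" using up p0p[OF x0] by (meson le_fun_def order_trans)
    ultimately show "u x0 = p x0" by simp
  qed
qed

end

lemma real_or_complex_cases: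
  obtains (real) "\<And>z::'k::real_or_complex. \<exists>a. z = of_real a"
  | (complex) i :: "'k::real_or_complex" where "i * i = - 1"
      "\<And>z. \<exists>a b. z = of_real a + of_real b * i"
      "\<And>a b. norm (of_real a + of_real b * i) = sqrt (a\<^sup>2 + b\<^sup>2)"
  using real_or_complex[where 'a='k]
  unfolding scaleR_conv_of_real mult_1_right by metis

lemma real_or_complex_complete:
  fixes s :: "nat \<Rightarrow> 'k::real_or_complex"
  assumes "Cauchy s"
  shows "\<exists>l. s \<longlonglongrightarrow> l"
proof (cases rule: real_or_complex_cases[where 'k = 'k])
  case real
  then have "\<forall>n. \<exists>a. s n = of_real a" by blast
  then obtain a where a: "\<And>n. s n = of_real (a n)" by metis
  have "Cauchy a"
    using assms unfolding Cauchy_def a dist_norm of_real_diff[symmetric] norm_of_real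
    by (simp add: dist_real_def)
  then obtain l where "a \<longlonglongrightarrow> l" using Cauchy_convergent_iff convergentD by blast
  then have "s \<longlonglongrightarrow> of_real l" unfolding a[abs_def] by (rule tendsto_of_real)
  then show ?thesis by blast
next
  case (complex i)
  have "\<forall>n. \<exists>a b. s n = of_real a + of_real b * i" using complex(2) by blast
  then obtain a b where ab: "\<And>n. s n = of_real (a n) + of_real (b n) * i" by metis
  have "norm (s m - s n) = sqrt ((a m - a n)\<^sup>2 + (b m - b n)\<^sup>2)" for m n
    using complex(3)[of "a m - a n" "b m - b n"] by (simp add: ab algebra_simps)
  then have "\<bar>a m - a n\<bar> \<le> norm (s m - s n)" "\<bar>b m - b n\<bar> \<le> norm (s m - s n)" for m n
    by (simp_all add: real_sqrt_sum_squares_ge1 real_sqrt_sum_squares_ge2 real_le_rsqrt)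
  then have "Cauchy a" "Cauchy b"
    using assms unfolding Cauchy_def dist_norm real_norm_def by (meson order.strict_trans1)+
  then obtain l l' where "a \<longlonglongrightarrow> l" "b \<longlonglongrightarrow> l'" using Cauchy_convergent_iff convergentD by metis
  then have "s \<longlonglongrightarrow> of_real l + of_real l' * i"
    unfolding ab[abs_def] by (intro tendsto_intros)
  then show ?thesis by blast
qed

text \<open>
  For complex scalars, a real linear \<open>u\<close> dominated by the norm is the real part of the complex
  linear functional \<open>x \<mapsto> u x - i u (i x)\<close>, whose norm is at most one as well.
\<close>

lemma norming_functional:
  fixes X :: "('k::real_or_complex, 'v::ab_group_add) nspace"
  assumes X: "normed_space X" and x0: "x0 \<in> carrier X"
  obtains f where "f \<in> dual_ball X" "norm (f x0) \<ge> nrm X x0"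
proof -
  let ?V = "carrier X" and ?sc = "\<lambda>r. scale X (of_real r :: 'k)"
  from X interpret K: vector_space "scale X" unfolding normed_space_def by blast
  have sub: "K.subspace ?V" using X unfolding normed_space_def by blast
  interpret R: vector_space ?sc
    by unfold_locales (simp_all add: K.scale_right_distrib K.scale_left_distrib)
  interpret R: real_subspace ?sc ?V
    using sub by unfold_locales (auto simp: K.subspace_def R.subspace_def)
  have nrm: "nrm X (scale X c x) = norm c * nrm X x" "nrm X (x + y) \<le> nrm X x + nrm X y"
    if "x \<in> ?V" "y \<in> ?V" for c x y using X that unfolding normed_space_def by auto
  have V: "x + y \<in> ?V" "scale X c x \<in> ?V" if "x \<in> ?V" "y \<in> ?V" for c x y
    using sub that by (auto simp: K.subspace_def)
  define p where "p x = (if x \<in> ?V then nrm X x else 0)" for x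
  have p: "sublinear_on ?sc ?V p"
    unfolding sublinear_on_def by (intro conjI ballI allI impI) (simp_all add: p_def V nrm)
  obtain u where u_add: "\<And>x y. x \<in> ?V \<Longrightarrow> y \<in> ?V \<Longrightarrow> u (x + y) = u x + u y"
    and u_sc: "\<And>c x. x \<in> ?V \<Longrightarrow> u (?sc c x) = c * u x"
    and u_le: "\<And>x. x \<in> ?V \<Longrightarrow> u x \<le> p x" and u_x0: "u x0 = p x0"
    using R.hahn_banach[OF p x0] by blast
  have u_le': "\<bar>u x\<bar> \<le> nrm X x" if x: "x \<in> ?V" for x
  proof -
    have "- x \<in> ?V" using K.subspace_neg[OF sub x] .
    then have "u (- x) \<le> p (- x)" by (rule u_le)
    moreover have "u (- x) = - u x" using u_sc[OF x, of "- 1"] by simp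
    moreover have "nrm X (- x) = nrm X x" using nrm(1)[OF x x, of "- 1"] by simp
    ultimately have "- u x \<le> nrm X x" using \<open>- x \<in> ?V\<close> by (simp add: p_def)
    moreover have "u x \<le> nrm X x" using u_le[OF x] x by (simp add: p_def)
    ultimately show ?thesis by simp
  qed
  have u_x0': "u x0 = nrm X x0" using u_x0 x0 by (simp add: p_def)
  have dualI: "f \<in> dual_ball X"
    if "\<And>x y. x \<in> ?V \<Longrightarrow> y \<in> ?V \<Longrightarrow> f (x + y) = f x + f y"
      "\<And>c x. x \<in> ?V \<Longrightarrow> f (scale X c x) = c * f x"
      "\<And>x. x \<in> ?V \<Longrightarrow> norm (f x) \<le> nrm X x" for f :: "'v \<Rightarrow> 'k"
    using that unfolding dual_ball_def dual_def bounded_operator_def scalar_space_def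
    by (auto intro!: exI[of _ 1])
  show ?thesis
  proof (cases rule: real_or_complex_cases[where 'k = 'k])
    case real
    have "(\<lambda>x. of_real (u x) :: 'k) \<in> dual_ball X"
    proof (rule dualI)
      fix c :: 'k and x assume x: "x \<in> ?V"
      obtain a where "c = of_real a" using real by blast
      then show "of_real (u (scale X c x)) = c * of_real (u x)" using u_sc[OF x, of a] by simp
    qed (use u_add u_le' in auto)
    then show ?thesis using u_x0' by (intro that) auto
  next
    case (complex i)
    define f where "f x = of_real (u x) - of_real (u (scale X i x)) * i" for x
    have f_norm: "norm (f x) = sqrt ((u x)\<^sup>2 + (u (scale X i x))\<^sup>2)" for x
      using complex(3)[of "u x" "- u (scale X i x)"] by (simp add: f_def)
    have f_add: "f (x + y) = f x + f y" if "x \<in> ?V" "y \<in> ?V" for x y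
      using that V by (simp add: f_def u_add K.scale_right_distrib algebra_simps)
    have f_scale: "f (scale X c x) = c * f x" if x: "x \<in> ?V" for c x
    proof -
      obtain a b where c: "c = of_real a + of_real b * i" using complex(2) by blast
      have ix: "scale X i x \<in> ?V" using V x by blast
      have lin: "u (?sc r y + ?sc s z) = r * u y + s * u z" if "y \<in> ?V" "z \<in> ?V" for r s y z
        using u_add[OF V(2)[OF that(1,1)] V(2)[OF that(2,2)]] u_sc that by simp
      have "scale X c x = ?sc a x + ?sc b (scale X i x)"
        by (simp add: c K.scale_left_distrib)
      from this[THEN arg_cong[of _ _ u]] lin[OF x ix, of a b]
      have 1: "u (scale X c x) = a * u x + b * u (scale X i x)" by (rule trans)
      have ii: "i * (i * z) = - z" for z using complex(1) by (metis mult.assoc mult_minus1)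
      have "scale X i (scale X c x) = ?sc a (scale X i x) + ?sc (- b) x"
      proof -
        have "i * (of_real b * i) = of_real b * (i * i)" by (rule mult.left_commute)
        then have "i * c = of_real a * i + of_real (- b)"
          by (simp add: c complex(1) distrib_left mult.commute)
        moreover have "scale X i (scale X c x) = scale X (i * c) x" by (rule K.scale_scale)
        ultimately have "scale X i (scale X c x) = scale X (of_real a * i) x + ?sc (- b) x"
          by (simp only: K.scale_left_distrib)
        then show ?thesis by (simp only: K.scale_scale)
      qed
      from this[THEN arg_cong[of _ _ u]] lin[OF ix x, of a "- b"]
      have "u (scale X i (scale X c x)) = a * u (scale X i x) + - b * u x" by (rule trans)
      then have 2: "u (scale X i (scale X c x)) = a * u (scale X i x) - b * u x" by simp
      have "f (scale X c x) = of_real (a * u x + b * u (scale X i x)) -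
          of_real (a * u (scale X i x) - b * u x) * i"
        unfolding f_def 1 2 ..
      also have "\<dots> = (of_real a + of_real b * i) * f x"
        unfolding f_def by (simp add: algebra_simps ii)
      finally show ?thesis unfolding c .
    qed
    have f_le: "norm (f x) \<le> nrm X x" if x: "x \<in> ?V" for x
    proof (cases "f x = 0")
      case True
      then show ?thesis using X x unfolding normed_space_def by simp
    next
      case False
      \<comment> \<open>Rotating \<open>x\<close> by \<open>c\<close> makes the value of \<open>f\<close> equal to its modulus.\<close>
      define c where "c = of_real (norm (f x)) / f x"
      have nc: "norm c = 1" using False by (simp add: c_def norm_divide)
      have "f (scale X c x) = of_real (norm (f x))" using f_scale[OF x] False by (simp add: c_def)
      then have "of_real (u (scale X c x) - norm (f x)) + of_real (- u (scale X i (scale X c x))) * i = 0"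
        by (simp add: f_def algebra_simps)
      then have "u (scale X c x) = norm (f x)"
        using complex(3)[of "u (scale X c x) - norm (f x)" "- u (scale X i (scale X c x))"]
        by (simp add: sum_power2_eq_zero_iff del: of_real_diff of_real_minus)
      then show ?thesis using u_le'[OF V(2)[OF x x, of c]] nrm(1)[OF x x, of c] nc by simp
    qed
    have "f \<in> dual_ball X" by (rule dualI[OF f_add f_scale f_le])
    moreover have "norm (f x0) \<ge> nrm X x0"
      unfolding f_norm u_x0' by (rule real_sqrt_sum_squares_ge1)
    ultimately show ?thesis by (rule that)
  qed
qed

section \<open>Weakly null sequences of countable order\<close>

lemma enumerate_range:
  assumes "strict_mono (h :: nat \<Rightarrow> nat)"
  shows "enumerate (range h) n = h n"
proof (induction n)
  case 0
  show ?case unfolding enumerate_0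
    using assms by (intro Least_equality) (auto simp: strict_mono_less_eq)
next
  case (Suc n)
  have "infinite (range h)" using assms by (simp add: range_inj_infinite strict_mono_imp_inj_on)
  then have "enumerate (range h) (Suc n) = (LEAST s. s \<in> range h \<and> enumerate (range h) n < s)"
    by (rule enumerate_Suc'')
  also have "\<dots> = h (Suc n)"
    unfolding Suc using assms
    by (intro Least_equality) (auto simp: strict_mono_less strict_mono_less_eq Suc_le_eq)
  finally show ?case .
qed

lemma strict_mono_from_one:
  assumes "infinite N" "N \<subseteq> {1..}"
  shows "\<exists>g :: nat \<Rightarrow> nat. strict_mono g \<and> (\<forall>n\<ge>1. g n = enumerate N (n - 1) \<and> g n \<in> N)"
proof -
  define g where "g n = (if n = 0 then 0 else enumerate N (n - 1))" for n :: nat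
  have N: "enumerate N n \<in> N" for n using assms(1) by (rule enumerate_in_set)
  have "strict_mono g"
    unfolding strict_mono_Suc_iff
  proof
    fix n
    show "g n < g (Suc n)"
    proof (cases n)
      case 0
      then show ?thesis using N[of 0] assms(2) by (auto simp: g_def)
    next
      case (Suc k)
      then show ?thesis using enumerate_step[OF assms(1), of k] by (simp add: g_def)
    qed
  qed
  then show ?thesis using N by (intro exI[of _ g]) (auto simp: g_def)
qed

lemma empty_in_large_sets: "{} \<in> large_sets X \<epsilon> x"
  unfolding large_sets_def by simp

lemma large_sets_nonempty_iff:
  "F \<noteq> {} \<Longrightarrow> F \<in> large_sets X \<epsilon> x \<longleftrightarrow>
    finite F \<and> F \<subseteq> {1..} \<and> (\<exists>f\<in>dual_ball X. \<forall>n\<in>F. \<epsilon> \<le> norm (f (x n)))"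
  unfolding large_sets_def by simp

context schreier begin

text \<open>
  Infinite subsets of \<open>{1..}\<close> are replaced by strictly increasing maps \<open>g\<close> on all of \<open>nat\<close>, the
  \<open>k\<close>-th element being \<open>g k\<close>; the value \<open>g 0\<close> plays no role.
\<close>

lemma ord_weakly_null_iff:
  "ord_weakly_null S (Ctbl \<xi>) X x \<longleftrightarrow>
    \<not> (\<exists>\<epsilon>>0. \<exists>g. strict_mono g \<and> (\<forall>E\<in>S \<xi>. g ` E \<in> large_sets X \<epsilon> x))"
proof -
  have "(\<exists>N. infinite N \<and> N \<subseteq> {1..} \<and> spread (S \<xi>) N \<subseteq> A) \<longleftrightarrow>
      (\<exists>g. strict_mono g \<and> (\<forall>E\<in>S \<xi>. g ` E \<in> A))" for A
  proof
    assume "\<exists>N. infinite N \<and> N \<subseteq> {1..} \<and> spread (S \<xi>) N \<subseteq> A"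
    then obtain N where N: "infinite N" "N \<subseteq> {1..}" and sp: "spread (S \<xi>) N \<subseteq> A" by blast
    obtain g where g: "strict_mono g" "\<And>n. 1 \<le> n \<Longrightarrow> g n = enumerate N (n - 1)"
      using strict_mono_from_one[OF N] by blast
    have "g ` E \<in> A" if "E \<in> S \<xi>" for E
    proof -
      have "g ` E = (\<lambda>n. enumerate N (n - 1)) ` E"
        using g(2) S_pos[OF that] by (intro image_cong) auto
      then show ?thesis using sp that unfolding spread_def by blast
    qed
    then show "\<exists>g. strict_mono g \<and> (\<forall>E\<in>S \<xi>. g ` E \<in> A)" using g(1) by blast
  next
    assume "\<exists>g. strict_mono g \<and> (\<forall>E\<in>S \<xi>. g ` E \<in> A)"
    then obtain g where g: "strict_mono g" and A: "\<And>E. E \<in> S \<xi> \<Longrightarrow> g ` E \<in> A" by blast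
    define h where "h n = g (Suc n)" for n
    have h: "strict_mono h" using g unfolding h_def strict_mono_Suc_iff by simp
    have "1 \<le> h n" for n using strict_mono_imp_increasing[OF g, of "Suc n"] by (simp add: h_def)
    then have "range h \<subseteq> {1..}" by auto
    moreover have "infinite (range h)" using h by (simp add: range_inj_infinite strict_mono_imp_inj_on)
    moreover have "spread (S \<xi>) (range h) \<subseteq> A"
    proof
      fix B assume "B \<in> spread (S \<xi>) (range h)"
      then obtain E where E: "E \<in> S \<xi>" "B = (\<lambda>n. h (n - 1)) ` E"
        unfolding spread_def enumerate_range[OF h] by blast
      have "Suc (k - 1) = k" if "k \<in> E" for k using S_pos[OF E(1) that] by simp
      then have "B = g ` E" unfolding E(2) h_def by (intro image_cong arg_cong[where f = g]) auto
      then show "B \<in> A" using A[OF E(1)] by simp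
    qed
    ultimately show "\<exists>N. infinite N \<and> N \<subseteq> {1..} \<and> spread (S \<xi>) N \<subseteq> A" by blast
  qed
  then show ?thesis by auto
qed

end

lemma frequently_imp_strict_mono:
  assumes "\<forall>m. \<exists>n\<ge>m. P (n::nat)"
  shows "\<exists>g :: nat \<Rightarrow> nat. strict_mono g \<and> (\<forall>n\<ge>1. P (g n))"
proof -
  have "infinite {n. 1 \<le> n \<and> P n}"
    unfolding infinite_nat_iff_unbounded_le
  proof
    fix m
    obtain n where "n \<ge> max m 1" "P n" using assms by blast
    then show "\<exists>n\<ge>m. n \<in> {n. 1 \<le> n \<and> P n}" by auto
  qed
  moreover have "{n. 1 \<le> n \<and> P n} \<subseteq> {1..}" by auto
  ultimately show ?thesis using strict_mono_from_one[of "{n. 1 \<le> n \<and> P n}"] by blast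
qed

lemma not_tendsto_zeroD:
  assumes "\<not> (u :: nat \<Rightarrow> real) \<longlonglongrightarrow> 0" "\<And>n. 1 \<le> n \<Longrightarrow> 0 \<le> u n"
  shows "\<exists>e>0. \<exists>g :: nat \<Rightarrow> nat. strict_mono g \<and> (\<forall>n\<ge>1. e \<le> u (g n))"
proof -
  obtain e where e: "0 < e" "\<forall>m. \<exists>n\<ge>m. e \<le> \<bar>u n\<bar>"
    using assms(1) unfolding LIMSEQ_def by (auto simp: not_less)
  obtain g where g: "strict_mono (g :: nat \<Rightarrow> nat)" "\<forall>n\<ge>1. e \<le> \<bar>u (g n)\<bar>"
    using frequently_imp_strict_mono[OF e(2)] by blast
  have "e \<le> u (g n)" if n: "1 \<le> n" for n
  proof -
    have "1 \<le> g n" using strict_mono_imp_increasing[OF g(1), of n] n by simp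
    then show ?thesis using g(2)[rule_format, OF n] assms(2)[of "g n"] by simp
  qed
  then show ?thesis using e(1) g(1) by blast
qed

lemma dual_ball_scaled:
  assumes "normed_space X" "f \<in> dual X"
  obtains C where "0 < C" "(\<lambda>x. f x / of_real C) \<in> dual_ball X"
proof -
  have "\<exists>C. \<forall>x\<in>carrier X. norm (f x) \<le> C * nrm X x"
    using assms(2) unfolding dual_def bounded_operator_def scalar_space_def by simp
  then obtain C where C: "\<And>x. x \<in> carrier X \<Longrightarrow> norm (f x) \<le> C * nrm X x" by blast
  let ?C = "max C 1"
  have le: "norm (f x / of_real ?C) \<le> nrm X x" if "x \<in> carrier X" for x
  proof -
    have "0 \<le> nrm X x" using assms(1) that unfolding normed_space_def by blast
    then have "norm (f x) \<le> ?C * nrm X x"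
      by (intro order_trans[OF C[OF that]] mult_right_mono) auto
    then show ?thesis by (simp add: norm_divide field_simps)
  qed
  then have "(\<lambda>x. f x / of_real ?C) \<in> dual_ball X"
    using assms(2) unfolding dual_ball_def dual_def bounded_operator_def scalar_space_def
    by (auto simp: add_divide_distrib intro!: exI[of _ 1])
  then show ?thesis by (intro that[of ?C]) auto
qed

context schreier begin

text \<open>
  \<open>S 0\<close> consists of the empty set and the singletons, so \<open>0\<close>-weak nullity concerns one
  vector at a time, and each vector has a norming functional.
\<close>

lemma ord_weakly_null_zero_imp_norm_null:
  assumes X: "normed_space X" and x: "sequence_in X x" and null: "ord_weakly_null S 0 X x"
  shows "norm_null X x"
proof (rule ccontr)
  assume "\<not> norm_null X x"
  then have "\<not> (\<lambda>n. nrm X (x n)) \<longlonglongrightarrow> 0" unfolding norm_null_def .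
  moreover have "0 \<le> nrm X (x n)" if "1 \<le> n" for n
    using X x that unfolding normed_space_def sequence_in_def by blast
  ultimately have "\<exists>e>0. \<exists>g :: nat \<Rightarrow> nat. strict_mono g \<and>
      (\<forall>n\<ge>1. e \<le> nrm X (x (g n)))"
    by (rule not_tendsto_zeroD)
  then obtain e and g :: "nat \<Rightarrow> nat" where e: "0 < e" and g: "strict_mono g"
    and ge': "\<forall>n\<ge>1. e \<le> nrm X (x (g n))" by blast
  have ge: "e \<le> nrm X (x (g n))" if "1 \<le> n" for n using ge' that by blast
  have g1: "1 \<le> g n" if "1 \<le> n" for n
    using strict_mono_imp_increasing[OF g, of n] that by simp
  have "g ` E \<in> large_sets X e x" if E: "E \<in> S 0" for E
  proof (cases "E = {}")
    case False
    have "finite E" "card E \<le> 1" using E by (auto simp: S_zero schreier_zero_def)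
    then have "card E = 1" using False by (simp add: le_Suc_eq card_eq_0_iff)
    then obtain k where k: "E = {k}" by (rule card_1_singletonE)
    then have "1 \<le> k" using S_pos[OF E] by simp
    then have "x (g k) \<in> carrier X" using x g1 unfolding sequence_in_def by blast
    then obtain f where "f \<in> dual_ball X" "norm (f (x (g k))) \<ge> nrm X (x (g k))"
      using X norming_functional by blast
    then show ?thesis using ge[OF \<open>1 \<le> k\<close>] g1[OF \<open>1 \<le> k\<close>] k
      by (subst large_sets_nonempty_iff) (auto intro: order_trans)
  qed (simp add: empty_in_large_sets)
  then have "\<not> ord_weakly_null S (Ctbl 0) X x" using e g unfolding ord_weakly_null_iff by blast
  then show False using null[unfolded zero_ordinal_def] by contradiction
qed

lemma ord_weakly_null_imp_weakly_null:
  assumes X: "normed_space X" and null: "ord_weakly_null S (Ctbl \<xi>) X x"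
  shows "weakly_null X x"
proof (rule ccontr)
  assume "\<not> weakly_null X x"
  then obtain f where f: "f \<in> dual X" "\<not> (\<lambda>n. f (x n)) \<longlonglongrightarrow> 0"
    unfolding weakly_null_def by blast
  have "\<not> (\<lambda>n. norm (f (x n))) \<longlonglongrightarrow> 0" using f(2) tendsto_norm_zero_iff by blast
  then have "\<exists>e>0. \<exists>g :: nat \<Rightarrow> nat. strict_mono g \<and>
      (\<forall>n\<ge>1. e \<le> norm (f (x (g n))))"
    by (rule not_tendsto_zeroD) simp
  then obtain e and g :: "nat \<Rightarrow> nat" where e: "0 < e" and g: "strict_mono g"
    and ge': "\<forall>n\<ge>1. e \<le> norm (f (x (g n)))" by blast
  have ge: "e \<le> norm (f (x (g n)))" if "1 \<le> n" for n using ge' that by blast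
  have g1: "1 \<le> g n" if "1 \<le> n" for n
    using strict_mono_imp_increasing[OF g, of n] that by simp
  obtain C where C: "0 < C" "(\<lambda>x. f x / of_real C) \<in> dual_ball X"
    using dual_ball_scaled[OF X f(1)] by blast
  have "g ` E \<in> large_sets X (e / C) x" if E: "E \<in> S \<xi>" for E
  proof (cases "E = {}")
    case False
    have "\<forall>n\<in>g ` E. e / C \<le> norm (f (x n) / of_real C)"
      using ge S_pos[OF E] C(1) by (auto simp: norm_divide divide_right_mono)
    then show ?thesis using False C(2) S_finite[OF E] S_pos[OF E] g1
      by (subst large_sets_nonempty_iff) auto
  qed (simp add: empty_in_large_sets)
  moreover have "0 < e / C" using e C(1) by simp
  ultimately show False using null g unfolding ord_weakly_null_iff by blast
qed

text \<open>
  If \<open>S z (N) \<subseteq> large_sets X \<epsilon> x\<close>, then the same holds for \<open>S y\<close> and \<open>N\<close> without its first \<open>m\<close>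
  elements, as the shifts by \<open>m\<close> of members of \<open>S y\<close> are members of \<open>S z\<close> for large \<open>m\<close>.
\<close>

lemma ord_weakly_null_mono:
  assumes X: "normed_space X" and "\<xi> \<le> \<zeta>" and null: "ord_weakly_null S \<xi> X x"
  shows "ord_weakly_null S \<zeta> X x"
proof (cases \<zeta>)
  case Omega1
  then show ?thesis using null ord_weakly_null_imp_weakly_null[OF X] by (cases \<xi>) auto
next
  case z: (Ctbl z)
  then obtain y where y: "\<xi> = Ctbl y" "y \<le> z" using \<open>\<xi> \<le> \<zeta>\<close> by (cases \<xi>) auto
  obtain m where m: "\<And>E. E \<in> S y \<Longrightarrow> (\<forall>j\<in>E. m \<le> j) \<Longrightarrow> E \<in> S z"
    using S_eventually_mono[OF y(2)] by blast
  show ?thesis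
    unfolding z ord_weakly_null_iff
  proof
    assume "\<exists>\<epsilon>>0. \<exists>g. strict_mono g \<and> (\<forall>E\<in>S z. g ` E \<in> large_sets X \<epsilon> x)"
    then obtain \<epsilon> g where g: "0 < \<epsilon>" "strict_mono g"
      and large: "\<And>E. E \<in> S z \<Longrightarrow> g ` E \<in> large_sets X \<epsilon> x" by blast
    let ?h = "\<lambda>k. k + m"
    have "(g \<circ> ?h) ` E \<in> large_sets X \<epsilon> x" if "E \<in> S y" for E
    proof -
      have "?h ` E \<in> S y" using that by (rule S_spread) (simp add: strict_mono_def)
      then have "?h ` E \<in> S z" by (rule m) auto
      then have "g ` ?h ` E \<in> large_sets X \<epsilon> x" by (rule large)
      then show ?thesis by (simp only: image_comp)
    qed
    moreover have "strict_mono (g \<circ> ?h)" using g(2) by (simp add: strict_mono_def)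
    ultimately show False using null g(1) unfolding y ord_weakly_null_iff by blast
  qed
qed

lemma cc_operators_eq: "cc_operators = ord_cc_operators S Omega1"
  unfolding cc_operators_def ord_cc_operators_def by simp

lemma ord_cc_operators_antimono:
  assumes "\<xi> \<le> \<zeta>"
  shows "ord_cc_operators S \<zeta> \<subseteq> ord_cc_operators S \<xi>"
  using ord_weakly_null_mono[OF _ assms]
  unfolding ord_cc_operators_def operators_def banach_space_def by blast

lemma operators_eq: "operators = ord_cc_operators S 0"
proof -
  have "norm_null Y (\<lambda>n. A (x n))"
    if "(X, Y, A) \<in> operators" "sequence_in X x" "ord_weakly_null S 0 X x" for X Y A x
  proof -
    have X: "normed_space X" and Y: "normed_space Y" and A: "bounded_operator X Y A"
      using that(1) unfolding operators_def banach_space_def by auto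
    have null: "(\<lambda>n. nrm X (x n)) \<longlonglongrightarrow> 0"
      using ord_weakly_null_zero_imp_norm_null[OF X that(2,3)] unfolding norm_null_def .
    obtain C where C: "\<And>z. z \<in> carrier X \<Longrightarrow> nrm Y (A z) \<le> C * nrm X z"
      using A unfolding bounded_operator_def by blast
    have x: "x n \<in> carrier X" if "1 \<le> n" for n using \<open>sequence_in X x\<close> that by (simp add: sequence_in_def)
    have "\<forall>\<^sub>F n in sequentially. 0 \<le> nrm Y (A (x n))"
    proof (rule eventually_sequentiallyI)
      fix n :: nat assume "1 \<le> n"
      then have "A (x n) \<in> carrier Y" using x A unfolding bounded_operator_def by blast
      then show "0 \<le> nrm Y (A (x n))" using Y unfolding normed_space_def by blast
    qed
    moreover have "\<forall>\<^sub>F n in sequentially. nrm Y (A (x n)) \<le> C * nrm X (x n)"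
      using x C unfolding eventually_sequentially by blast
    moreover have "(\<lambda>n. C * nrm X (x n)) \<longlonglongrightarrow> 0" using tendsto_mult_right_zero[OF null] .
    ultimately show ?thesis unfolding norm_null_def
      by (rule tendsto_sandwich[OF _ _ tendsto_const])
  qed
  then show ?thesis unfolding ord_cc_operators_def by auto
qed

end

section \<open>Sequence spaces defined by weighted sums\<close>

text \<open>
  The weighted \<open>\<ell>\<^sub>1\<close> seminorm given by a weight and a finite set of coordinates.
\<close>

definition weighted_sum :: "real \<times> nat set \<Rightarrow> (nat \<Rightarrow> 'k::real_normed_field) \<Rightarrow> real" where
  "weighted_sum w x = fst w * (\<Sum>i\<in>snd w. norm (x i))"

text \<open>
  The scalar null sequences for which the supremum of the weighted sums over \<open>W\<close> is finite, normed by
  this supremum. Index \<open>0\<close> is a coordinate like any other.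
\<close>

definition weighted_space ::
  "(real \<times> nat set) set \<Rightarrow> ('k::real_or_complex, nat \<Rightarrow> 'k) nspace" where
  "weighted_space W =
    \<lparr>carrier = {x. x \<longlonglongrightarrow> 0 \<and> bdd_above ((\<lambda>w. weighted_sum w x) ` W)},
     scale = (\<lambda>c x i. c * x i),
     nrm = (\<lambda>x. SUP w\<in>W. weighted_sum w x)\<rparr>"

lemma vector_space_pointwise: "vector_space (\<lambda>(c::'k::field) x (i::'i). c * x i)"
  by unfold_locales (auto simp: fun_eq_iff algebra_simps)

lemma scale_weighted_space [simp]: "scale (weighted_space W) c x = (\<lambda>i. c * x i)"
  by (simp add: weighted_space_def)

text \<open>
  The weight \<open>1\<close> on singletons makes the norm dominate the supremum norm.
\<close>

locale weights =
  fixes W :: "(real \<times> nat set) set"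
  assumes weight_nonneg: "w \<in> W \<Longrightarrow> 0 \<le> fst w"
    and singleton_weight: "(1, {i}) \<in> W"
begin

lemma weighted_spaceI:
  assumes "x \<longlonglongrightarrow> 0" "\<And>w. w \<in> W \<Longrightarrow> weighted_sum w x \<le> b"
  shows "x \<in> carrier (weighted_space W)" "nrm (weighted_space W) x \<le> b"
proof -
  show "x \<in> carrier (weighted_space W)"
    using assms by (auto simp: weighted_space_def intro!: bdd_aboveI2)
  have "W \<noteq> {}" using singleton_weight by blast
  then show "nrm (weighted_space W) x \<le> b"
    using assms(2) by (auto simp: weighted_space_def intro!: cSUP_least)
qed

lemma weighted_sum_le_nrm:
  assumes "x \<in> carrier (weighted_space W)" "w \<in> W"
  shows "weighted_sum w x \<le> nrm (weighted_space W) x"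
  using assms by (auto simp: weighted_space_def intro!: cSUP_upper)

lemma coordinate_le_nrm:
  assumes "x \<in> carrier (weighted_space W)"
  shows "norm (x i) \<le> nrm (weighted_space W) x"
  using weighted_sum_le_nrm[OF assms singleton_weight[of i]] by (simp add: weighted_sum_def)

lemma weighted_sum_add:
  assumes "w \<in> W"
  shows "weighted_sum w (x + y) \<le> weighted_sum w x + weighted_sum w y"
proof -
  have "(\<Sum>i\<in>snd w. norm ((x + y) i)) \<le> (\<Sum>i\<in>snd w. norm (x i) + norm (y i))"
    by (intro sum_mono) (simp add: norm_triangle_ineq)
  then show ?thesis
    unfolding weighted_sum_def distrib_left[symmetric] sum.distrib[symmetric]
    by (rule mult_left_mono) (rule weight_nonneg[OF assms])
qed

lemma weighted_sum_scale: "weighted_sum w (\<lambda>i. c * x i) = norm c * weighted_sum w x"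
  by (simp add: weighted_sum_def norm_mult sum_distrib_left mult_ac)

lemma tendsto_zero_weighted_space: "x \<in> carrier (weighted_space W) \<Longrightarrow> x \<longlonglongrightarrow> 0"
  by (simp add: weighted_space_def)

lemma normed_weighted_space: "normed_space (weighted_space W :: ('k::real_or_complex, nat \<Rightarrow> 'k) nspace)"
proof -
  let ?X = "weighted_space W :: ('k, nat \<Rightarrow> 'k) nspace"
  interpret vector_space "\<lambda>(c::'k) (x :: nat \<Rightarrow> 'k) i. c * x i"
    by (rule vector_space_pointwise)
  have sc: "scale ?X = (\<lambda>c x i. c * x i)" by (simp add: weighted_space_def)
  have W_le: "weighted_sum w x \<le> nrm ?X x" if "x \<in> carrier ?X" "w \<in> W" for x w
    using that by (rule weighted_sum_le_nrm)
  have add: "x + y \<in> carrier ?X" "nrm ?X (x + y) \<le> nrm ?X x + nrm ?X y"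
    if x: "x \<in> carrier ?X" and y: "y \<in> carrier ?X" for x y
  proof -
    have "(\<lambda>i. x i + y i) \<longlonglongrightarrow> 0 + 0"
      using x y by (intro tendsto_add tendsto_zero_weighted_space)
    then have lim: "(x + y) \<longlonglongrightarrow> 0" by (simp add: plus_fun_def)
    have le: "weighted_sum w (x + y) \<le> nrm ?X x + nrm ?X y" if "w \<in> W" for w
      using weighted_sum_add[OF that, of x y] W_le[OF x that] W_le[OF y that] by linarith
    show "x + y \<in> carrier ?X" "nrm ?X (x + y) \<le> nrm ?X x + nrm ?X y"
      by (rule weighted_spaceI[OF lim le]; assumption)+
  qed
  have scl: "(\<lambda>i. c * x i) \<in> carrier ?X" "nrm ?X (\<lambda>i. c * x i) \<le> norm c * nrm ?X x"
    if x: "x \<in> carrier ?X" for c x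
  proof -
    have lim: "(\<lambda>i. c * x i) \<longlonglongrightarrow> 0"
      using x by (intro tendsto_mult_right_zero tendsto_zero_weighted_space)
    have le: "weighted_sum w (\<lambda>i. c * x i) \<le> norm c * nrm ?X x" if "w \<in> W" for w
      unfolding weighted_sum_scale using W_le[OF x that] by (rule mult_left_mono) simp
    show "(\<lambda>i. c * x i) \<in> carrier ?X" "nrm ?X (\<lambda>i. c * x i) \<le> norm c * nrm ?X x"
      by (rule weighted_spaceI[OF lim le]; assumption)+
  qed
  have zero: "0 \<in> carrier ?X" "nrm ?X 0 \<le> 0"
  proof -
    have lim: "(0 :: nat \<Rightarrow> 'k) \<longlonglongrightarrow> 0" by (simp add: zero_fun_def)
    have le: "weighted_sum w (0 :: nat \<Rightarrow> 'k) \<le> 0" for w by (simp add: weighted_sum_def)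
    show "0 \<in> carrier ?X" "nrm ?X 0 \<le> 0" by (rule weighted_spaceI[OF lim le])+
  qed
  have nonneg: "0 \<le> nrm ?X x" if "x \<in> carrier ?X" for x
    using order_trans[OF norm_ge_zero coordinate_le_nrm[OF that, of 0]] .
  have scl_eq: "nrm ?X (\<lambda>i. c * x i) = norm c * nrm ?X x" if x: "x \<in> carrier ?X" for c x
  proof (cases "c = 0")
    case True
    then have "(\<lambda>i. c * x i) = 0" by (simp add: zero_fun_def)
    then show ?thesis using True zero nonneg[OF zero(1)] by simp
  next
    case False
    have "nrm ?X (\<lambda>i. inverse c * (c * x i)) \<le> norm (inverse c) * nrm ?X (\<lambda>i. c * x i)"
      by (rule scl(2)[OF scl(1)[OF x]])
    then have "nrm ?X x \<le> norm (inverse c) * nrm ?X (\<lambda>i. c * x i)"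
      using False by (simp add: mult.assoc[symmetric])
    then have "norm c * nrm ?X x \<le> nrm ?X (\<lambda>i. c * x i)"
      using False by (simp add: norm_inverse norm_divide field_simps)
    then show ?thesis using scl(2)[OF x, of c] by simp
  qed
  have sub: "subspace (carrier ?X)"
    unfolding subspace_def using zero(1) add(1) scl(1) by blast
  have def0: "x = 0" if "x \<in> carrier ?X" "nrm ?X x = 0" for x
    using coordinate_le_nrm[OF that(1)] that(2) by (auto simp: fun_eq_iff)
  show ?thesis
    unfolding normed_space_def sc
    using vector_space_axioms sub nonneg def0 zero nonneg[OF zero(1)] scl_eq add(2) by auto
qed

lemma banach_weighted_space: "banach_space (weighted_space W :: ('k::real_or_complex, nat \<Rightarrow> 'k) nspace)"
proof -
  let ?X = "weighted_space W :: ('k, nat \<Rightarrow> 'k) nspace"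
  interpret vector_space "\<lambda>(c::'k) (x :: nat \<Rightarrow> 'k) i. c * x i"
    by (rule vector_space_pointwise)
  have sub: "subspace (carrier ?X)"
    using normed_weighted_space[where 'k = 'k] by (simp add: normed_space_def weighted_space_def)
  have "\<exists>l\<in>carrier ?X. (\<lambda>n. nrm ?X (s n - l)) \<longlonglongrightarrow> 0"
    if s: "\<And>n. s n \<in> carrier ?X"
      and cauchy: "\<And>e. 0 < e \<Longrightarrow> \<exists>M. \<forall>m\<ge>M. \<forall>n\<ge>M. nrm ?X (s m - s n) < e" for s
  proof -
    have diff: "s m - s n \<in> carrier ?X" for m n using s by (intro subspace_diff[OF sub])
    have "\<exists>l. (\<lambda>n. s n i) \<longlonglongrightarrow> l" for i
    proof (rule real_or_complex_complete)
      show "Cauchy (\<lambda>n. s n i)"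
        unfolding Cauchy_iff
      proof (intro allI impI)
        fix e :: real assume "0 < e"
        then obtain M where M: "\<forall>m\<ge>M. \<forall>n\<ge>M. nrm ?X (s m - s n) < e" using cauchy by blast
        have coord: "norm (s m i - s n i) \<le> nrm ?X (s m - s n)" for m n
          using coordinate_le_nrm[OF diff, of m n i] by simp
        from M show "\<exists>M. \<forall>m\<ge>M. \<forall>n\<ge>M. norm (s m i - s n i) < e"
          using order.strict_trans1[OF coord] by blast
      qed
    qed
    then obtain l where l: "\<And>i. (\<lambda>n. s n i) \<longlonglongrightarrow> l i" by metis
    have close: "weighted_sum w (s m - l) \<le> e"
      if M: "\<forall>m\<ge>M. \<forall>n\<ge>M. nrm ?X (s m - s n) < e" and m: "M \<le> m" and w: "w \<in> W" for M e m w
    proof (rule tendsto_upperbound)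
      show "(\<lambda>n. weighted_sum w (s m - s n)) \<longlonglongrightarrow> weighted_sum w (s m - l)"
        unfolding weighted_sum_def minus_apply by (intro tendsto_intros l)
      show "\<forall>\<^sub>F n in sequentially. weighted_sum w (s m - s n) \<le> e"
      proof (rule eventually_sequentiallyI)
        fix n assume "M \<le> n"
        then have "nrm ?X (s m - s n) < e" using M m by blast
        then show "weighted_sum w (s m - s n) \<le> e"
          using weighted_sum_le_nrm[OF diff w, of m n] by simp
      qed
    qed simp
    have uniform: "\<exists>M. \<forall>m\<ge>M. \<forall>w\<in>W. weighted_sum w (s m - l) \<le> e" if e: "0 < e" for e
    proof -
      obtain M where "\<forall>m\<ge>M. \<forall>n\<ge>M. nrm ?X (s m - s n) < e" using cauchy[OF e] by blast
      then show ?thesis using close by blast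
    qed
    have lim: "l \<longlonglongrightarrow> 0"
      unfolding LIMSEQ_iff
    proof (intro allI impI)
      fix e :: real assume "0 < e"
      then obtain M where M: "\<forall>w\<in>W. weighted_sum w (s M - l) \<le> e / 2"
        using uniform[of "e / 2"] by auto
      have near: "norm (s M i - l i) \<le> e / 2" for i
        using bspec[OF M singleton_weight[of i]] by (simp add: weighted_sum_def)
      obtain N where N: "\<And>i. i \<ge> N \<Longrightarrow> norm (s M i) < e / 2"
        using tendsto_zero_weighted_space[OF s, of M] \<open>0 < e\<close>
        unfolding LIMSEQ_iff by (metis diff_zero half_gt_zero)
      have "norm (l i - 0) < e" if "i \<ge> N" for i
        using norm_triangle_ineq4[of "s M i" "s M i - l i"] near[of i] N[OF that] by simp
      then show "\<exists>N. \<forall>i\<ge>N. norm (l i - 0) < e" by blast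
    qed
    have lim_diff: "(s m - l) \<longlonglongrightarrow> 0" for m
      using tendsto_diff[OF tendsto_zero_weighted_space[OF s, of m] lim] by (simp add: fun_diff_def)
    obtain M where "\<forall>w\<in>W. weighted_sum w (s M - l) \<le> 1" using uniform[of 1] by auto
    then have "s M - l \<in> carrier ?X" using weighted_spaceI(1)[OF lim_diff] by blast
    then have "s M - (s M - l) \<in> carrier ?X" by (rule subspace_diff[OF sub s])
    then have "l \<in> carrier ?X" by simp
    moreover have "(\<lambda>n. nrm ?X (s n - l)) \<longlonglongrightarrow> 0"
      unfolding LIMSEQ_iff
    proof (intro allI impI)
      fix e :: real assume "0 < e"
      then obtain M where M: "\<forall>m\<ge>M. \<forall>w\<in>W. weighted_sum w (s m - l) \<le> e / 2"
        using uniform[of "e / 2"] by auto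
      have "norm (nrm ?X (s m - l) - 0) < e" if "m \<ge> M" for m
      proof -
        have "nrm ?X (s m - l) \<le> e / 2" using M that by (intro weighted_spaceI(2)[OF lim_diff]) blast
        moreover have "0 \<le> nrm ?X (s m - l)"
          using order_trans[OF norm_ge_zero coordinate_le_nrm[OF subspace_diff[OF sub s \<open>l \<in> carrier ?X\<close>], of _ 0]] .
        ultimately show ?thesis using \<open>0 < e\<close> by simp
      qed
      then show "\<exists>M. \<forall>m\<ge>M. norm (nrm ?X (s m - l) - 0) < e" by blast
    qed
    ultimately show ?thesis by blast
  qed
  then show ?thesis unfolding banach_space_def using normed_weighted_space by blast
qed

lemma weighted_dual_ballI:
  assumes "\<And>x y. f (x + y) = f x + f y" "\<And>c x. f (\<lambda>i. c * x i) = c * f x"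
    "\<And>x. x \<in> carrier (weighted_space W) \<Longrightarrow> norm (f x) \<le> nrm (weighted_space W) x"
  shows "f \<in> dual_ball (weighted_space W)"
  using assms unfolding dual_ball_def dual_def bounded_operator_def scalar_space_def
  by (auto intro!: exI[of _ 1])

lemma weighted_coordinate_sum_dual_ball:
  assumes "(c, F) \<in> W"
  shows "(\<lambda>x. of_real c * (\<Sum>i\<in>F. x i)) \<in> dual_ball (weighted_space W)"
proof (rule weighted_dual_ballI)
  fix x assume x: "x \<in> carrier (weighted_space W)"
  have "norm (of_real c * (\<Sum>i\<in>F. x i)) \<le> weighted_sum (c, F) x"
    using weight_nonneg[OF assms]
    by (simp add: weighted_sum_def norm_mult mult_left_mono sum_norm_le)
  also have "\<dots> \<le> nrm (weighted_space W) x" by (rule weighted_sum_le_nrm[OF x assms])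
  finally show "norm (of_real c * (\<Sum>i\<in>F. x i)) \<le> nrm (weighted_space W) x" .
qed (simp_all add: sum.distrib sum_distrib_left algebra_simps)

end

section \<open>Operators of prescribed index\<close>

definition unit_vector :: "nat \<Rightarrow> nat \<Rightarrow> 'k::real_or_complex" where
  "unit_vector n = (\<lambda>i. if i = n then 1 else 0)"

text \<open>
  The coefficients of the combination are its coordinates, at the distinct positions \<open>g k\<close>.
\<close>

lemma weighted_sum_combination:
  fixes a :: "nat \<Rightarrow> 'k::real_or_complex"
  assumes "finite E" "finite F" "inj_on g E"
  shows "weighted_sum (c, F) (\<lambda>i. \<Sum>k\<in>E. a k * unit_vector (g k) i) =
    c * (\<Sum>k\<in>{k\<in>E. g k \<in> F}. norm (a k))"
proof -
  let ?z = "\<lambda>i. \<Sum>k\<in>E. a k * unit_vector (g k) i"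
  have at: "?z (g k) = a k" if "k \<in> E" for k
  proof -
    have "?z (g k) = (\<Sum>l\<in>E. if l = k then a k else 0)"
      using that assms(3) by (intro sum.cong) (auto simp: unit_vector_def inj_on_def)
    then show ?thesis using that assms(1) by simp
  qed
  have off: "?z i = 0" if "i \<notin> g ` E" for i
    using that by (intro sum.neutral) (auto simp: unit_vector_def)
  have "norm (?z i) = 0" if "i \<in> F - g ` {k\<in>E. g k \<in> F}" for i
  proof -
    have "i \<notin> g ` E" using that by blast
    then show ?thesis using off by simp
  qed
  then have "(\<Sum>i\<in>F. norm (?z i)) = (\<Sum>i\<in>g ` {k\<in>E. g k \<in> F}. norm (?z i))"
    using assms(2) by (intro sum.mono_neutral_right) auto
  also have "\<dots> = (\<Sum>k\<in>{k\<in>E. g k \<in> F}. norm (?z (g k)))"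
    using assms(3) by (subst sum.reindex) (auto simp: inj_on_def)
  also have "\<dots> = (\<Sum>k\<in>{k\<in>E. g k \<in> F}. norm (a k))"
    by (intro sum.cong) (auto simp: at)
  finally show ?thesis by (simp add: weighted_sum_def)
qed

context weights begin

lemma combination_in_weighted_space:
  fixes a :: "nat \<Rightarrow> 'k::real_or_complex"
  assumes "finite E" "\<And>n. (unit_vector (g n) :: nat \<Rightarrow> 'k) \<in> carrier (weighted_space W)" "f \<in> dual (weighted_space W)"
  shows "(\<lambda>i. \<Sum>k\<in>E. a k * unit_vector (g k) i) \<in> carrier (weighted_space W) \<and>
    f (\<lambda>i. \<Sum>k\<in>E. a k * unit_vector (g k) i) = (\<Sum>k\<in>E. a k * f (unit_vector (g k)))"
  using assms(1)
proof (induction E rule: finite_induct)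
  case empty
  let ?X = "weighted_space W :: ('k, nat \<Rightarrow> 'k) nspace"
  interpret vector_space "\<lambda>(c::'k) (x::nat \<Rightarrow> 'k) i. c * x i" by (rule vector_space_pointwise)
  have "subspace (carrier ?X)"
    using normed_weighted_space[where 'k = 'k] by (simp add: normed_space_def weighted_space_def)
  then have zero: "(\<lambda>i. 0) \<in> carrier ?X" using subspace_0 by (simp add: zero_fun_def)
  have "f (scale ?X 0 (\<lambda>i. 0)) = scale scalar_space 0 (f (\<lambda>i. 0))"
    using assms(3) zero unfolding dual_def bounded_operator_def by blast
  then show ?case using zero by (simp add: scalar_space_def)
next
  case (insert k E)
  let ?X = "weighted_space W :: ('k, nat \<Rightarrow> 'k) nspace"
  let ?z = "\<lambda>i. \<Sum>k\<in>E. a k * unit_vector (g k) i" and ?y = "\<lambda>i. a k * unit_vector (g k) i"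
  interpret vector_space "\<lambda>(c::'k) (x::nat \<Rightarrow> 'k) i. c * x i" by (rule vector_space_pointwise)
  have sub: "subspace (carrier ?X)"
    using normed_weighted_space[where 'k = 'k] by (simp add: normed_space_def weighted_space_def)
  have y: "?y \<in> carrier ?X" using subspace_scale[OF sub assms(2)] .
  have eq: "(\<lambda>i. \<Sum>k\<in>insert k E. a k * unit_vector (g k) i) = ?y + ?z"
    using insert.hyps by (simp add: plus_fun_def)
  have "f (?y + ?z) = f ?y + f ?z"
    using assms(3) y insert.IH unfolding dual_def bounded_operator_def by blast
  moreover have "f (scale ?X (a k) (unit_vector (g k))) =
      scale scalar_space (a k) (f (unit_vector (g k)))"
    using assms(2)[of k] assms(3) unfolding dual_def bounded_operator_def by blast
  then have "f ?y = a k * f (unit_vector (g k))" by (simp add: scalar_space_def)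
  ultimately show ?case unfolding eq using insert subspace_add[OF sub y] by simp
qed

end

text \<open>
  With these weights \<open>weighted_space\<close> is the space of null sequences with the supremum norm.
\<close>

definition supremum_weights :: "(real \<times> nat set) set" where
  "supremum_weights = {(1, {i}) | i. True}"

interpretation supremum: weights supremum_weights
  by unfold_locales (auto simp: supremum_weights_def)

text \<open>
  An enumeration of the ordinals below \<open>\<xi>\<close>, with repetitions allowed.
\<close>

locale schreier_space = schreier +
  fixes \<xi> :: countable_ordinal and \<eta> :: "nat \<Rightarrow> countable_ordinal"
  assumes range_\<eta>: "range \<eta> = {\<zeta>. \<zeta> < \<xi>}"
begin

text \<open>
  The norm is the larger of the supremum norm and the supremum of the Schreier norms of all orders
  below \<open>\<xi>\<close>, the latter damped by weights that tend to zero. The damping is what makes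
  limit ordinals \<open>\<xi>\<close> possible: up to a small error only finitely many orders matter, and these have a maximum below \<open>\<xi>\<close>.
\<close>

definition schreier_weights :: "(real \<times> nat set) set" where
  "schreier_weights = supremum_weights \<union> {(1 / Suc n, F) | n F. F \<in> S (\<eta> n)}"

sublocale weights schreier_weights
  by unfold_locales (auto simp: schreier_weights_def supremum_weights_def)

abbreviation schreier_nspace :: "('k::real_or_complex, nat \<Rightarrow> 'k) nspace" where
  "schreier_nspace \<equiv> weighted_space schreier_weights"

abbreviation supremum_nspace :: "('k::real_or_complex, nat \<Rightarrow> 'k) nspace" where
  "supremum_nspace \<equiv> weighted_space supremum_weights"

lemma schreier_weights_cases:
  assumes "w \<in> schreier_weights"
  obtains i where "w = (1, {i})" | n F where "w = (1 / Suc n, F)" "F \<in> S (\<eta> n)"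
  using assms unfolding schreier_weights_def supremum_weights_def by blast

lemma identity_bounded:
  "bounded_operator (schreier_nspace :: ('k::real_or_complex, nat \<Rightarrow> 'k) nspace) supremum_nspace (\<lambda>x. x)"
proof -
  have "x \<in> carrier supremum_nspace \<and> nrm supremum_nspace x \<le> 1 * nrm schreier_nspace x"
    if "x \<in> carrier schreier_nspace" for x :: "nat \<Rightarrow> 'k"
  proof -
    have le: "weighted_sum w x \<le> nrm schreier_nspace x" if "w \<in> supremum_weights" for w
      using weighted_sum_le_nrm[OF \<open>x \<in> _\<close>] that unfolding schreier_weights_def by blast
    from supremum.weighted_spaceI[OF tendsto_zero_weighted_space[OF that] le]
    show ?thesis by simp
  qed
  then show ?thesis unfolding bounded_operator_def by (auto intro!: exI[of _ 1])
qed

lemma unit_vector_in_space: "(unit_vector n :: nat \<Rightarrow> 'k::real_or_complex) \<in> carrier schreier_nspace"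
proof (rule weighted_spaceI(1))
  show "(unit_vector n :: nat \<Rightarrow> 'k) \<longlonglongrightarrow> 0"
    by (rule tendsto_eventually) (auto simp: unit_vector_def eventually_sequentially intro!: exI[of _ "Suc n"])
  fix w assume "w \<in> schreier_weights"
  moreover have "(\<Sum>i\<in>F. norm (unit_vector n i :: 'k)) \<le> 1" for F
  proof (cases "finite F")
    case True
    have "(\<Sum>i\<in>F. norm (unit_vector n i :: 'k)) = (\<Sum>i\<in>F. if i = n then 1 else 0)"
      by (intro sum.cong) (auto simp: unit_vector_def)
    then show ?thesis using True by simp
  qed simp
  moreover have "fst w \<le> 1" using \<open>w \<in> schreier_weights\<close> by (cases rule: schreier_weights_cases) auto
  ultimately have "fst w * (\<Sum>i\<in>snd w. norm (unit_vector n i :: 'k)) \<le> 1 * 1"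
    by (intro mult_mono) (auto intro: sum_nonneg)
  then show "weighted_sum w (unit_vector n :: nat \<Rightarrow> 'k) \<le> 1" by (simp add: weighted_sum_def)
qed

text \<open>
  If \<open>S \<xi> (N)\<close> consisted of large sets, a functional of norm at most one would be at least \<open>\<epsilon>\<close> in
  modulus at all unit vectors carried by a repeated average, hence also at the average itself after
  the signs have been adjusted. But the average has norm at most \<open>\<epsilon> / 2\<close>.
\<close>

lemma unit_vectors_weakly_null:
  assumes "0 < \<xi>"
  shows "ord_weakly_null S (Ctbl \<xi>) (schreier_nspace :: ('k::real_or_complex, nat \<Rightarrow> 'k) nspace) unit_vector"
  unfolding ord_weakly_null_iff
proof
  let ?X = "schreier_nspace :: ('k, nat \<Rightarrow> 'k) nspace"
  assume "\<exists>\<epsilon>>0. \<exists>g. strict_mono g \<and> (\<forall>E\<in>S \<xi>. g ` E \<in> large_sets ?X \<epsilon> unit_vector)"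
  then obtain \<epsilon> and g :: "nat \<Rightarrow> nat" where \<epsilon>: "0 < \<epsilon>" and g: "strict_mono g"
    and large: "\<forall>E\<in>S \<xi>. g ` E \<in> large_sets ?X \<epsilon> unit_vector" by blast
  obtain K where "2 / \<epsilon> < real K" using reals_Archimedean2 by blast
  then have K': "2 < \<epsilon> * real K" using \<epsilon> by (simp add: field_simps)
  have K: "1 / real (Suc n) \<le> \<epsilon> / 2" if "K < n" for n
  proof -
    have "\<epsilon> * real K \<le> \<epsilon> * real (Suc n)" using \<epsilon> that by (intro mult_left_mono) auto
    then have "2 \<le> \<epsilon> * real (Suc n)" using K' by simp
    then show ?thesis by (simp add: field_simps del: of_nat_Suc)
  qed
  \<comment> \<open>Orders \<open>\<eta> n\<close> with \<open>K < n\<close> contribute at most \<open>\<epsilon> / 2\<close> to the norm of an average.\<close>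
  define \<theta> where "\<theta> = Max (\<eta> ` {..K})"
  have "\<theta> \<in> \<eta> ` {..K}" unfolding \<theta>_def by (intro Max_in) auto
  then have "\<theta> < \<xi>" using range_\<eta> by auto
  then have "ord_succ \<theta> \<le> \<xi>" by (simp add: ord_succ_le_iff)
  then obtain m1 where m1: "\<And>E. E \<in> S (ord_succ \<theta>) \<Longrightarrow> (\<forall>j\<in>E. m1 \<le> j) \<Longrightarrow> E \<in> S \<xi>"
    using S_eventually_mono by blast
  obtain m2 where m2: "\<And>E. E \<in> S 0 \<Longrightarrow> (\<forall>j\<in>E. m2 \<le> j) \<Longrightarrow> E \<in> S \<theta>"
    using S_eventually_mono[OF zero_le_countable_ordinal] by blast
  have "\<exists>m. \<forall>E\<in>S (\<eta> n). (\<forall>j\<in>E. m \<le> j) \<longrightarrow> E \<in> S \<theta>" if "n \<le> K" for n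
  proof -
    have "\<eta> n \<le> \<theta>" unfolding \<theta>_def using that by (intro Max_ge) auto
    then show ?thesis by (rule S_eventually_mono) blast
  qed
  then obtain m3 where m3: "\<And>n. n \<le> K \<Longrightarrow> \<forall>E\<in>S (\<eta> n). (\<forall>j\<in>E. m3 n \<le> j) \<longrightarrow> E \<in> S \<theta>" by metis
  define M where "M = Max (insert m1 (insert m2 (m3 ` {..K})))"
  have M1: "m1 \<le> M" and M2: "m2 \<le> M" and M3: "n \<le> K \<Longrightarrow> m3 n \<le> M" for n
    unfolding M_def by (rule Max_ge; force)+
  have "0 < \<epsilon> / 2" using \<epsilon> by simp
  then obtain E \<mu> where avg: "index_average (S (ord_succ \<theta>)) (S \<theta>) g M (\<epsilon> / 2) E \<mu>"
    using repeated_averages[OF g, of "\<epsilon> / 2" \<theta> M] by blast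
  have E: "E \<in> S (ord_succ \<theta>)" and EM: "k \<in> E \<Longrightarrow> M < k" and \<mu>0: "0 \<le> \<mu> k" and \<mu>1: "sum \<mu> E = 1"
    and mass: "F \<in> S \<theta> \<Longrightarrow> sum \<mu> {k\<in>E. g k \<in> F} < \<epsilon> / 2" for k F
    using avg unfolding index_average_def by auto
  have finE: "finite E" using S_finite[OF E] .
  have g_ge: "k \<le> g k" for k using g by (simp add: strict_mono_imp_increasing)
  have "E \<in> S \<xi>" using EM M1 by (intro m1[OF E]) (auto dest!: EM)
  then have "g ` E \<in> large_sets ?X \<epsilon> unit_vector" using large by blast
  moreover have ne: "g ` E \<noteq> {}" using \<mu>1 by auto
  ultimately have "\<exists>f\<in>dual_ball ?X. \<forall>n\<in>g ` E. \<epsilon> \<le> norm (f (unit_vector n))"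
    using large_sets_nonempty_iff[OF ne, of ?X \<epsilon> unit_vector] by simp
  then obtain f where f: "f \<in> dual_ball ?X"
    and f_ge: "\<forall>n\<in>g ` E. \<epsilon> \<le> norm (f (unit_vector n))" by blast
  \<comment> \<open>The second factor is a scalar of modulus one that makes the \<open>k\<close>-th term of \<open>f z\<close> nonnegative.\<close>
  define a where "a k = of_real (\<mu> k) * (of_real (norm (f (unit_vector (g k)))) / f (unit_vector (g k)))" for k
  define z where "z = (\<lambda>i. \<Sum>k\<in>E. a k * unit_vector (g k) i)"
  have f_nz: "f (unit_vector (g k)) \<noteq> 0" if "k \<in> E" for k using f_ge that \<epsilon> by force
  have norm_a: "norm (a k) = \<mu> k" if "k \<in> E" for k
    using f_nz[OF that] \<mu>0[of k] by (simp add: a_def norm_mult norm_divide)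
  have z: "z \<in> carrier ?X" and fz: "f z = (\<Sum>k\<in>E. a k * f (unit_vector (g k)))"
    using combination_in_weighted_space[OF finE unit_vector_in_space, where f = f and g = g and a = a] f
    unfolding z_def dual_ball_def by auto
  have "f z = (\<Sum>k\<in>E. of_real (\<mu> k * norm (f (unit_vector (g k)))))"
    unfolding fz using f_nz by (intro sum.cong) (auto simp: a_def)
  then have "f z = of_real (\<Sum>k\<in>E. \<mu> k * norm (f (unit_vector (g k))))" by simp
  then have "norm (f z) = (\<Sum>k\<in>E. \<mu> k * norm (f (unit_vector (g k))))"
    using \<mu>0 by (simp only: norm_of_real) (intro abs_of_nonneg sum_nonneg mult_nonneg_nonneg norm_ge_zero)
  moreover have "(\<Sum>k\<in>E. \<mu> k * \<epsilon>) \<le> (\<Sum>k\<in>E. \<mu> k * norm (f (unit_vector (g k))))"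
    using f_ge \<mu>0 by (intro sum_mono mult_left_mono) auto
  moreover have "(\<Sum>k\<in>E. \<mu> k * \<epsilon>) = \<epsilon>" using \<mu>1 by (simp flip: sum_distrib_right)
  ultimately have lower: "\<epsilon> \<le> norm (f z)" by simp
  have "nrm ?X z \<le> \<epsilon> / 2"
  proof (rule weighted_spaceI(2)[OF tendsto_zero_weighted_space[OF z]])
    fix w assume w: "w \<in> schreier_weights"
    have sum_w: "weighted_sum (c, F) z = c * sum \<mu> {k\<in>E. g k \<in> F}" if "finite F" for c F
      unfolding z_def using strict_mono_imp_inj_on[OF g]
      by (subst weighted_sum_combination[OF finE that]) (auto simp: norm_a inj_on_def)
    have le1: "sum \<mu> {k\<in>E. g k \<in> F} \<le> 1" for F
      unfolding \<mu>1[symmetric] using finE \<mu>0 by (intro sum_mono2) auto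
    have tail: "sum \<mu> {k\<in>E. g k \<in> F} < \<epsilon> / 2" if "F \<inter> {M..} \<in> S \<theta>" for F
    proof -
      have "M \<le> g k" if "k \<in> E" for k using EM[OF that] g_ge[of k] by linarith
      then have "{k\<in>E. g k \<in> F} = {k\<in>E. g k \<in> F \<inter> {M..}}" by blast
      then show ?thesis using mass[OF that] by simp
    qed
    show "weighted_sum w z \<le> \<epsilon> / 2"
      using w
    proof (cases rule: schreier_weights_cases)
      case (1 i)
      show ?thesis
      proof (cases "M \<le> i \<and> 1 \<le> i")
        case True
        then have i: "{i} \<inter> {M..} \<in> S 0" by (simp add: S_zero schreier_zero_def)
        have "\<forall>j\<in>{i} \<inter> {M..}. m2 \<le> j" using M2 by auto
        then have "{i} \<inter> {M..} \<in> S \<theta>" by (rule m2[OF i])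
        then have "sum \<mu> {k\<in>E. g k \<in> {i}} \<le> \<epsilon> / 2" using tail less_imp_le by blast
        moreover have "weighted_sum (1, {i}) z = 1 * sum \<mu> {k\<in>E. g k \<in> {i}}" by (rule sum_w) simp
        ultimately show ?thesis unfolding 1 by simp
      next
        case False
        have "i < g k" if "k \<in> E" for k using EM[OF that] g_ge[of k] False by linarith
        then have none: "{k\<in>E. g k \<in> {i}} = {}" by fastforce
        have "weighted_sum (1, {i}) z = 1 * sum \<mu> {k\<in>E. g k \<in> {i}}" by (rule sum_w) simp
        then show ?thesis unfolding 1 none using \<epsilon> by simp
      qed
    next
      case (2 n F)
      have finF: "finite F" using S_finite[OF 2(2)] .
      have nonneg: "0 \<le> sum \<mu> {k\<in>E. g k \<in> F}" using \<mu>0 by (intro sum_nonneg) auto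
      show ?thesis
      proof (cases "n \<le> K")
        case True
        have "\<forall>j\<in>F \<inter> {M..}. m3 n \<le> j" using M3[OF True] by auto
        then have "F \<inter> {M..} \<in> S \<theta>" using m3[OF True] S_tail[OF 2(2), of M] by blast
        then have "sum \<mu> {k\<in>E. g k \<in> F} \<le> \<epsilon> / 2" using tail less_imp_le by blast
        moreover have "1 / real (Suc n) * sum \<mu> {k\<in>E. g k \<in> F} \<le> sum \<mu> {k\<in>E. g k \<in> F}"
          using nonneg by (intro mult_left_le_one_le) auto
        ultimately show ?thesis unfolding 2(1) sum_w[OF finF] by linarith
      next
        case False
        have "1 / real (Suc n) * sum \<mu> {k\<in>E. g k \<in> F} \<le> 1 / real (Suc n) * 1"
          by (intro mult_left_mono le1) auto
        also have "\<dots> \<le> \<epsilon> / 2" using K False by simp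
        finally show ?thesis unfolding 2(1) sum_w[OF finF] .
      qed
    qed
  qed
  moreover have "norm (f z) \<le> nrm ?X z" using f z unfolding dual_ball_def by blast
  ultimately show False using lower \<epsilon> by simp
qed

lemma supremum_large_coordinate:
  assumes "x \<in> carrier supremum_nspace" "b < nrm supremum_nspace x"
  shows "\<exists>i. b < norm (x i)"
proof (rule ccontr)
  assume "\<not> ?thesis"
  then have "weighted_sum w x \<le> b" if "w \<in> supremum_weights" for w
    using that by (auto simp: supremum_weights_def weighted_sum_def not_less)
  from supremum.weighted_spaceI(2)[OF supremum.tendsto_zero_weighted_space[OF assms(1)] this]
  show False using assms(2) by simp
qed

text \<open>
  Rows are null sequences, columns tend to zero, and infinitely many rows have an entry above \<open>\<delta>\<close>.
  The rows \<open>h k\<close> and the positions \<open>M k\<close> of large entries in them can be chosen so far apart that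
  the entries of row \<open>h k\<close> at the other positions \<open>M j\<close> add up to at most \<open>\<delta> / 2\<close> in modulus.
\<close>

lemma gliding_hump:
  fixes x :: "nat \<Rightarrow> nat \<Rightarrow> 'k::real_normed_field"
  assumes "0 < \<delta>"
    and rows: "\<And>n. 1 \<le> n \<Longrightarrow> x n \<longlonglongrightarrow> 0"
    and columns: "\<And>i. (\<lambda>n. x n i) \<longlonglongrightarrow> 0"
    and large: "\<forall>m. \<exists>n\<ge>m. \<exists>i. \<delta> < norm (x n i)"
  shows "\<exists>h M :: nat \<Rightarrow> nat. strict_mono h \<and> strict_mono M \<and> (\<forall>k. 1 \<le> h k) \<and>
    (\<forall>k F. finite F \<longrightarrow> k \<in> F \<longrightarrow> \<delta> / 2 \<le> norm (\<Sum>j\<in>F. x (h k) (M j)))"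
proof -
  let ?I = "{n. 1 \<le> n \<and> (\<exists>i. \<delta> < norm (x n i))}"
  let ?b = "\<lambda>n. \<delta> / 8 * (1 / 2) ^ n"
  have b: "0 < ?b n" for n using \<open>0 < \<delta>\<close> by simp
  have "\<exists>m. \<forall>n\<in>?I. \<delta> < norm (x n (m n))"
    by (rule bchoice[of ?I "\<lambda>n i. \<delta> < norm (x n i)"]) simp
  then obtain m where m: "\<And>n. n \<in> ?I \<Longrightarrow> \<delta> < norm (x n (m n))" by blast
  \<comment> \<open>Beyond \<open>t n\<close> the rows \<open>1, \<dots>, n\<close> are small.\<close>
  have "\<exists>t. m n \<le> t \<and> (\<forall>l\<in>{1..n}. \<forall>i>t. norm (x l i) \<le> ?b n)" for n
  proof -
    have "\<forall>\<^sub>F i in sequentially. norm (x l i) < ?b n" if "l \<in> {1..n}" for l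
      using rows[of l] that b[of n] by (intro order_tendstoD(2)[OF tendsto_norm_zero]) auto
    then have "\<forall>\<^sub>F i in sequentially. \<forall>l\<in>{1..n}. norm (x l i) < ?b n"
      by (intro eventually_ball_finite) auto
    then obtain t where "\<forall>i\<ge>t. \<forall>l\<in>{1..n}. norm (x l i) < ?b n"
      unfolding eventually_sequentially by blast
    then show ?thesis by (intro exI[of _ "max t (m n)"]) (auto intro: less_imp_le)
  qed
  then obtain t where t_ge: "\<And>n. m n \<le> t n"
    and t: "\<And>n l i. l \<in> {1..n} \<Longrightarrow> t n < i \<Longrightarrow> norm (x l i) \<le> ?b n" by metis
  have step: "\<exists>n'. n' \<in> ?I \<and> n < n' \<and> (\<forall>i\<le>t n. norm (x n' i) \<le> ?b i)" for n
  proof -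
    have "\<forall>\<^sub>F n' in sequentially. norm (x n' i) < ?b i" for i
      using columns[of i] b[of i] by (intro order_tendstoD(2)[OF tendsto_norm_zero]) auto
    then have "\<forall>\<^sub>F n' in sequentially. \<forall>i\<in>{..t n}. norm (x n' i) < ?b i"
      by (intro eventually_ball_finite) auto
    then obtain N where N: "\<forall>n'\<ge>N. \<forall>i\<in>{..t n}. norm (x n' i) < ?b i"
      unfolding eventually_sequentially by blast
    obtain n' where "n' \<ge> max (Suc n) N" "\<exists>i. \<delta> < norm (x n' i)" using large by blast
    then show ?thesis using N by (intro exI[of _ n']) (auto intro: less_imp_le)
  qed
  have "\<exists>h. \<forall>k. h k \<in> ?I \<and> (h k < h (Suc k) \<and> (\<forall>i\<le>t (h k). norm (x (h (Suc k)) i) \<le> ?b i))"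
  proof (rule dependent_nat_choice)
    show "\<exists>n. n \<in> ?I" using step[of 0] by blast
    show "\<exists>y. y \<in> ?I \<and> (n < y \<and> (\<forall>i\<le>t n. norm (x y i) \<le> ?b i))" for n using step[of n] by blast
  qed
  then obtain h where hI: "\<And>k. h k \<in> ?I" and h_Suc: "\<And>k. h k < h (Suc k)"
    and h_small: "\<And>k i. i \<le> t (h k) \<Longrightarrow> norm (x (h (Suc k)) i) \<le> ?b i" by blast
  define M where "M k = m (h k)" for k
  have big: "\<delta> < norm (x (h k) (M k))" for k unfolding M_def by (rule m[OF hI])
  have h: "strict_mono h" using h_Suc unfolding strict_mono_Suc_iff by blast
  have b_less: "?b i \<le> \<delta>" for i
  proof -
    have "?b i \<le> \<delta> / 8 * 1" using \<open>0 < \<delta>\<close> by (intro mult_left_mono) (auto simp: power_le_one)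
    then show ?thesis using \<open>0 < \<delta>\<close> by simp
  qed
  have t_M: "t (h k) < M (Suc k)" for k
    using h_small[of "M (Suc k)" k] big[of "Suc k"] b_less[of "M (Suc k)"] by (meson not_le order.strict_trans2 order_trans)
  have M: "strict_mono M" unfolding strict_mono_Suc_iff
    using t_ge[of "h _"] t_M unfolding M_def by (meson le_less_trans)
  have le_h: "k \<le> h k" and le_M: "k \<le> M k" for k
    using h M by (simp_all add: strict_mono_imp_increasing)
  have b_mono: "?b i \<le> ?b j" if "j \<le> i" for i j
    using \<open>0 < \<delta>\<close> that by (intro mult_left_mono power_decreasing) auto
  have cross: "norm (x (h k) (M j)) \<le> \<delta> / 4 * (1 / 2) ^ j" if "j \<noteq> k" for j k
  proof (cases "j < k")
    case True
    then obtain k' where k': "k = Suc k'" "j \<le> k'" by (cases k) auto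
    have "M j \<le> M k'" using M k' by (simp add: strict_mono_less_eq)
    also have "\<dots> \<le> t (h k')" using t_ge unfolding M_def .
    finally have "norm (x (h k) (M j)) \<le> ?b (M j)" unfolding k'(1) by (rule h_small)
    also have "\<dots> \<le> ?b j" by (rule b_mono[OF le_M])
    also have "\<dots> \<le> \<delta> / 4 * (1 / 2) ^ j" using \<open>0 < \<delta>\<close> by simp
    finally show ?thesis .
  next
    case False
    then have "k < j" using that by simp
    then obtain j' where j': "j = Suc j'" "k \<le> j'" by (cases j) auto
    have "h k \<le> h j'" using h j' by (simp add: strict_mono_less_eq)
    then have "h k \<in> {1..h j'}" using hI[of k] by simp
    then have "norm (x (h k) (M j)) \<le> ?b (h j')" unfolding j'(1) using t_M by (rule t)
    also have "\<dots> \<le> ?b j'" by (rule b_mono[OF le_h])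
    also have "\<dots> = \<delta> / 4 * (1 / 2) ^ j" by (simp add: j'(1))
    finally show ?thesis .
  qed
  have "\<delta> / 2 \<le> norm (\<Sum>j\<in>F. x (h k) (M j))" if F: "finite F" "k \<in> F" for k F
  proof -
    have "norm (\<Sum>j\<in>F - {k}. x (h k) (M j)) \<le> (\<Sum>j\<in>F - {k}. \<delta> / 4 * (1 / 2) ^ j)"
      by (intro order_trans[OF norm_sum] sum_mono cross) auto
    also have "\<dots> = \<delta> / 4 * (\<Sum>j\<in>F - {k}. (1 / 2) ^ j)" by (rule sum_distrib_left[symmetric])
    also have "(\<Sum>j\<in>F - {k}. (1 / 2) ^ j) \<le> (\<Sum>j. (1 / 2 :: real) ^ j)"
      using F by (intro sum_le_suminf summable_geometric) auto
    also have "(\<Sum>j. (1 / 2 :: real) ^ j) = 2" by (subst suminf_geometric) auto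
    finally have rest: "norm (\<Sum>j\<in>F - {k}. x (h k) (M j)) \<le> \<delta> / 2" using \<open>0 < \<delta>\<close> by simp
    have "(\<Sum>j\<in>F. x (h k) (M j)) = x (h k) (M k) + (\<Sum>j\<in>F - {k}. x (h k) (M j))"
      using F by (rule sum.remove)
    then show ?thesis
      using norm_diff_ineq[of "x (h k) (M k)" "\<Sum>j\<in>F - {k}. x (h k) (M j)"] rest big[of k] by simp
  qed
  then show ?thesis using h M hI by (intro exI[of _ h] exI[of _ M]) auto
qed

lemma weakly_null_imp_coordinate_null:
  assumes "weakly_null schreier_nspace x"
  shows "(\<lambda>n. x n i) \<longlonglongrightarrow> 0"
proof -
  have "(\<lambda>y. of_real 1 * (\<Sum>j\<in>{i}. y j)) \<in> dual schreier_nspace"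
    using weighted_coordinate_sum_dual_ball[OF singleton_weight[of i]] unfolding dual_ball_def by blast
  then show ?thesis using assms unfolding weakly_null_def by force
qed

text \<open>
  A \<open>\<zeta>\<close>-weakly null sequence is weakly null. If its supremum norms did not tend to zero, there would
  be, by the gliding hump, a subsequence indexed by \<open>h\<close> such that the weighted coordinate sum over
  \<open>M ` F\<close>, for each \<open>F \<in> S \<zeta>\<close>, is bounded below in modulus at the members of the subsequence with
  index in \<open>F\<close>. These sums are functionals of norm at most one.
\<close>

lemma identity_cc_below:
  assumes x: "sequence_in (schreier_nspace :: ('k::real_or_complex, nat \<Rightarrow> 'k) nspace) x"
    and null: "ord_weakly_null S (Ctbl \<zeta>) schreier_nspace x" and "\<zeta> < \<xi>"
  shows "norm_null supremum_nspace x"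
proof (rule ccontr)
  let ?X = "schreier_nspace :: ('k, nat \<Rightarrow> 'k) nspace"
  let ?Y = "supremum_nspace :: ('k, nat \<Rightarrow> 'k) nspace"
  assume "\<not> norm_null ?Y x"
  then have "\<not> (\<lambda>n. nrm ?Y (x n)) \<longlonglongrightarrow> 0" unfolding norm_null_def .
  moreover have xX: "x n \<in> carrier ?X" if "1 \<le> n" for n using x that unfolding sequence_in_def by blast
  have xY: "x n \<in> carrier ?Y" if "1 \<le> n" for n
    using identity_bounded xX[OF that] unfolding bounded_operator_def by blast
  then have "0 \<le> nrm ?Y (x n)" if "1 \<le> n" for n
    using supremum.normed_weighted_space that unfolding normed_space_def by blast
  ultimately have "\<exists>e>0. \<exists>g :: nat \<Rightarrow> nat. strict_mono g \<and> (\<forall>n\<ge>1. e \<le> nrm ?Y (x (g n)))"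
    by (rule not_tendsto_zeroD)
  then obtain e and g :: "nat \<Rightarrow> nat" where e: "0 < e" and g: "strict_mono g"
    and ge: "\<forall>n\<ge>1. e \<le> nrm ?Y (x (g n))" by blast
  have large: "\<forall>m. \<exists>n\<ge>m. \<exists>i. e / 2 < norm (x n i)"
  proof
    fix m
    have gm: "Suc m \<le> g (Suc m)" by (rule strict_mono_imp_increasing[OF g])
    have "e \<le> nrm ?Y (x (g (Suc m)))" using ge by simp
    then have "\<exists>i. e / 2 < norm (x (g (Suc m)) i)"
      using e gm by (intro supremum_large_coordinate xY) auto
    then show "\<exists>n\<ge>m. \<exists>i. e / 2 < norm (x n i)" using gm by (intro exI[of _ "g (Suc m)"]) auto
  qed
  have "weakly_null ?X x" using normed_weighted_space null by (rule ord_weakly_null_imp_weakly_null)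
  then have columns: "(\<lambda>n. x n i) \<longlonglongrightarrow> 0" for i by (rule weakly_null_imp_coordinate_null)
  have rows: "x n \<longlonglongrightarrow> 0" if "1 \<le> n" for n by (rule tendsto_zero_weighted_space[OF xX[OF that]])
  have "\<exists>h M :: nat \<Rightarrow> nat. strict_mono h \<and> strict_mono M \<and> (\<forall>k. 1 \<le> h k) \<and>
      (\<forall>k F. finite F \<longrightarrow> k \<in> F \<longrightarrow> e / 2 / 2 \<le> norm (\<Sum>j\<in>F. x (h k) (M j)))"
    by (rule gliding_hump[OF _ rows columns large]) (use e in simp_all)
  then obtain h M :: "nat \<Rightarrow> nat" where h: "strict_mono h" and M: "strict_mono M"
    and h1: "\<forall>k. 1 \<le> h k"
    and hump': "\<forall>k F. finite F \<longrightarrow> k \<in> F \<longrightarrow> e / 2 / 2 \<le> norm (\<Sum>j\<in>F. x (h k) (M j))"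
    by blast
  have hump: "e / 2 / 2 \<le> norm (\<Sum>j\<in>F. x (h k) (M j))" if "finite F" "k \<in> F" for k F
    using hump' that by blast
  obtain n where n: "\<zeta> = \<eta> n" using \<open>\<zeta> < \<xi>\<close> range_\<eta> by blast
  let ?c = "1 / real (Suc n)"
  have "h ` F \<in> large_sets ?X (?c * (e / 2 / 2)) x" if F: "F \<in> S \<zeta>" for F
  proof (cases "F = {}")
    case False
    have finF: "finite F" by (rule S_finite[OF F])
    have "M ` F \<in> S (\<eta> n)" using S_spread[OF F M] n by simp
    then have "(?c, M ` F) \<in> schreier_weights" unfolding schreier_weights_def by blast
    then have f: "(\<lambda>y. of_real ?c * (\<Sum>i\<in>M ` F. y i)) \<in> dual_ball ?X"
      by (rule weighted_coordinate_sum_dual_ball)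
    have "?c * (e / 2 / 2) \<le> norm (of_real ?c * (\<Sum>i\<in>M ` F. x (h k) i))" if "k \<in> F" for k
    proof -
      have "(\<Sum>i\<in>M ` F. x (h k) i) = (\<Sum>j\<in>F. x (h k) (M j))"
        using strict_mono_imp_inj_on[OF M] by (subst sum.reindex) (auto simp: inj_on_def)
      moreover have "norm (of_real ?c * s) = ?c * norm s" for s :: 'k
        by (simp only: norm_mult norm_of_real) simp
      ultimately show ?thesis using mult_left_mono[OF hump[OF finF that], of ?c] by simp
    qed
    then have "\<forall>k\<in>h ` F. ?c * (e / 2 / 2) \<le> norm (of_real ?c * (\<Sum>i\<in>M ` F. x k i))" by blast
    then have "\<exists>f\<in>dual_ball ?X. \<forall>k\<in>h ` F. ?c * (e / 2 / 2) \<le> norm (f (x k))"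
      by (rule bexI[OF _ f])
    moreover have "finite (h ` F)" using finF by (rule finite_imageI)
    moreover have "h ` F \<subseteq> {1..}" using h1 by auto
    moreover have ne: "h ` F \<noteq> {}" using False by simp
    ultimately show ?thesis unfolding large_sets_nonempty_iff[OF ne] by (intro conjI)
  qed (simp add: empty_in_large_sets)
  moreover have "0 < ?c * (e / 2 / 2)" using e by simp
  ultimately show False using null h unfolding ord_weakly_null_iff by blast
qed

lemma identity_v_index:
  assumes "0 < \<xi>"
  shows "v_index S (schreier_nspace :: ('k::real_or_complex, nat \<Rightarrow> 'k) nspace,
    supremum_nspace :: ('k, nat \<Rightarrow> 'k) nspace, \<lambda>x. x) = Ctbl \<xi>"
proof -
  let ?T = "(schreier_nspace :: ('k, nat \<Rightarrow> 'k) nspace,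
    supremum_nspace :: ('k, nat \<Rightarrow> 'k) nspace, \<lambda>x :: nat \<Rightarrow> 'k. x)"
  have op: "?T \<in> operators"
    unfolding operators_def
    using banach_weighted_space supremum.banach_weighted_space identity_bounded by blast
  have "norm (unit_vector n n :: 'k) \<le> nrm supremum_nspace (unit_vector n :: nat \<Rightarrow> 'k)" for n
    using identity_bounded unit_vector_in_space
    by (intro supremum.coordinate_le_nrm) (auto simp: bounded_operator_def)
  then have ge1: "1 \<le> nrm supremum_nspace (unit_vector n :: nat \<Rightarrow> 'k)" for n
    by (simp add: unit_vector_def)
  have "\<not> norm_null supremum_nspace (unit_vector :: nat \<Rightarrow> nat \<Rightarrow> 'k)"
  proof
    assume "norm_null supremum_nspace (unit_vector :: nat \<Rightarrow> nat \<Rightarrow> 'k)"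
    then have "1 \<le> (0::real)" unfolding norm_null_def using ge1 by (intro LIMSEQ_le_const) auto
    then show False by simp
  qed
  moreover have "sequence_in (schreier_nspace :: ('k, nat \<Rightarrow> 'k) nspace) unit_vector"
    unfolding sequence_in_def using unit_vector_in_space by blast
  ultimately have not_in: "?T \<notin> ord_cc_operators S (Ctbl \<xi>)"
    unfolding ord_cc_operators_def using unit_vectors_weakly_null[OF assms, where 'k = 'k] by blast
  have below: "?T \<in> ord_cc_operators S (Ctbl \<zeta>)" if "\<zeta> < \<xi>" for \<zeta>
    unfolding ord_cc_operators_def using op identity_cc_below[OF _ _ that] by blast
  have "(LEAST \<zeta>. ?T \<notin> ord_cc_operators S (Ctbl \<zeta>)) = \<xi>"
    using not_in below by (intro Least_equality) (auto simp: not_less[symmetric])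
  then show ?thesis using not_in unfolding v_index_def by auto
qed

end

context schreier begin

lemma v_index_attained:
  assumes "0 < \<xi>"
  shows "\<exists>(X :: ('k::real_or_complex, nat \<Rightarrow> 'k) nspace) (Y :: ('k, nat \<Rightarrow> 'k) nspace) A. banach_space X \<and> banach_space Y \<and>
    bounded_operator X Y A \<and> v_index S (X, Y, A) = Ctbl \<xi>"
proof -
  have "range (from_nat_into {\<zeta>. \<zeta> < \<xi>}) = {\<zeta>. \<zeta> < \<xi>}"
    using countable_below assms by (intro range_from_nat_into) auto
  then interpret schreier_space L S \<xi> "from_nat_into {\<zeta>. \<zeta> < \<xi>}" by unfold_locales
  let ?X = "weighted_space schreier_weights :: ('k, nat \<Rightarrow> 'k) nspace"
  let ?Y = "weighted_space supremum_weights :: ('k, nat \<Rightarrow> 'k) nspace"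
  have "banach_space ?X \<and> banach_space ?Y \<and> bounded_operator ?X ?Y (\<lambda>x. x) \<and>
      v_index S (?X, ?Y, \<lambda>x. x) = Ctbl \<xi>"
    by (intro conjI banach_weighted_space supremum.banach_weighted_space identity_bounded
        identity_v_index[OF assms])
  then show ?thesis by (intro exI)
qed

lemma ord_cc_operators_strict:
  assumes "\<xi> < \<zeta>"
  shows "(ord_cc_operators S \<zeta> :: ('k::real_or_complex, nat \<Rightarrow> 'k, nat \<Rightarrow> 'k) operator set)
    \<subset> ord_cc_operators S \<xi>"
proof -
  obtain y where y: "\<xi> = Ctbl y" using assms by (cases \<xi>; cases \<zeta>) (auto simp: less_ordinal_def)
  have "0 < ord_succ y" using zero_le_countable_ordinal less_ord_succ by (rule le_less_trans)
  then obtain X Y :: "('k, nat \<Rightarrow> 'k) nspace" and A where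
    T: "banach_space X" "banach_space Y" "bounded_operator X Y A" "v_index S (X, Y, A) = Ctbl (ord_succ y)"
    using v_index_attained[where 'k = 'k] by blast
  let ?P = "\<lambda>\<zeta>. (X, Y, A) \<notin> ord_cc_operators S (Ctbl \<zeta>)"
  have ex: "\<exists>\<zeta>. ?P \<zeta>" and least: "(LEAST \<zeta>. ?P \<zeta>) = ord_succ y"
    using T(4) unfolding v_index_def by (auto split: if_splits)
  have "?P (ord_succ y)" using LeastI_ex[OF ex] unfolding least .
  moreover have "Ctbl (ord_succ y) \<le> \<zeta>"
    using assms y by (cases \<zeta>) (auto simp: less_ordinal_def ord_succ_le_iff)
  ultimately have "(X, Y, A) \<notin> ord_cc_operators S \<zeta>"
    using ord_cc_operators_antimono by blast
  moreover have "(X, Y, A) \<in> ord_cc_operators S \<xi>"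
    using not_less_Least[of y ?P] less_ord_succ[of y] unfolding least y by blast
  ultimately show ?thesis using ord_cc_operators_antimono[OF less_imp_le[OF assms]] by blast
qed

end

section \<open>Proof of the theorem\<close>

theorem proposition3p8:
  fixes L :: "countable_ordinal \<Rightarrow> nat \<Rightarrow> countable_ordinal"
    and S :: "countable_ordinal \<Rightarrow> nat set set"
  assumes "schreier_families L S"
  shows
    "(cc_operators :: ('k::real_or_complex, 'v::ab_group_add, 'w::ab_group_add) operator set)
        = ord_cc_operators S Omega1 \<and>
     (operators :: ('k, 'v, 'w) operator set) = ord_cc_operators S 0 \<and>
     (\<forall>\<xi> \<zeta>. 0 \<le> \<xi> \<and> \<xi> \<le> \<zeta> \<and> \<zeta> \<le> Omega1 \<longrightarrow>
        (ord_cc_operators S \<zeta> :: ('k, 'v, 'w) operator set) \<subseteq> ord_cc_operators S \<xi>) \<and>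
     (\<forall>\<xi>. 0 < \<xi> \<and> \<xi> < Omega1 \<longrightarrow>
        (\<exists>(X :: ('k, nat \<Rightarrow> 'k) nspace) (Y :: ('k, nat \<Rightarrow> 'k) nspace) A.
           banach_space X \<and> banach_space Y \<and> bounded_operator X Y A \<and>
           v_index S (X, Y, A) = \<xi>)) \<and>
     (\<forall>\<xi> \<zeta>. 0 \<le> \<xi> \<and> \<xi> < \<zeta> \<and> \<zeta> \<le> Omega1 \<longrightarrow>
        (ord_cc_operators S \<zeta> :: ('k, nat \<Rightarrow> 'k, nat \<Rightarrow> 'k) operator set)
          \<subset> ord_cc_operators S \<xi>)"
proof -
  interpret schreier L S by unfold_locales (rule assms)
  show ?thesis
  proof (intro conjI allI impI)
    show "(cc_operators :: ('k, 'v, 'w) operator set) = ord_cc_operators S Omega1"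
      by (rule cc_operators_eq)
    show "(operators :: ('k, 'v, 'w) operator set) = ord_cc_operators S 0"
      by (rule operators_eq)
    show "(ord_cc_operators S \<zeta> :: ('k, 'v, 'w) operator set) \<subseteq> ord_cc_operators S \<xi>"
      if "0 \<le> \<xi> \<and> \<xi> \<le> \<zeta> \<and> \<zeta> \<le> Omega1" for \<xi> \<zeta>
      using that by (intro ord_cc_operators_antimono) simp
    show "\<exists>(X :: ('k, nat \<Rightarrow> 'k) nspace) (Y :: ('k, nat \<Rightarrow> 'k) nspace) A.
        banach_space X \<and> banach_space Y \<and> bounded_operator X Y A \<and> v_index S (X, Y, A) = \<xi>"
      if "0 < \<xi> \<and> \<xi> < Omega1" for \<xi>
    proof -
      have "\<xi> \<noteq> Omega1" using that by blast
      then obtain y where y: "\<xi> = Ctbl y" using ordinal.exhaust by blast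
      then have "0 < y" using that by (auto simp: zero_ordinal_def less_ordinal_def)
      then show ?thesis unfolding y by (rule v_index_attained)
    qed
    show "(ord_cc_operators S \<zeta> :: ('k, nat \<Rightarrow> 'k, nat \<Rightarrow> 'k) operator set) \<subset> ord_cc_operators S \<xi>"
      if "0 \<le> \<xi> \<and> \<xi> < \<zeta> \<and> \<zeta> \<le> Omega1" for \<xi> \<zeta>
      using that by (intro ord_cc_operators_strict) simp
  qed
qed

end
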